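(* Let $m,n\ge 2$ be even integers. The partition function $Z_{m,n}$ of the monopole-dimer model on the grid graph $Q_{m,n}$ with vertex weights $z$ and edge weights $a$ and $b$, viewed as a polynomial in the indeterminates $a,b,z$, is the square of a polynomial in $a,b,z$ with positive integer coefficients (i.e. all of whose nonzero coefficients are positive integers).
   Context: Grid graph: $Q_{m,n}$ has vertex set $\{(i,j): 1\le i\le m,\ 1\le j\le n\}$ with its standard planar embedding as points of $\mathbb{Z}^2$. Edges $\{(i,j),(i,j+1)\}$ have weight $a$, edges $\{(i,j),(i+1,j)\}$ have weight $b$, and every vertex has weight $z$. Monopole-dimer configuration on a plane graph $G=[V,E]$: a collection $C$ of pairwise vertex-disjoint directed loops of even length in $G$, where a loop of length $2$ is a doubled edge (exactly one such loop for each edge) and a loop of length $2k\ge4$ is a directed simple cycle (so each undirected cycle gives two distinct directed loops). Every vertex is either isolated (a monopole) or belongs to exactly one loop. Weights: the weight of a loop $\ell$ is $w(\ell)=(-1)^{N(\ell)}$ times the product of the weights of the edges traversed by $\ell$ (for a doubled edge, the square of the edge weight), where $N(\ell)$ is the number of vertices of $V$ strictly enclosed by $\ell$. The weight $w(C)$ is the product of $w(\ell)$ over the loops $\ell$ of $C$ and of the vertex weights over the isolated vertices of $C$. The partition function is $Z=\sum_C w(C)$, summed over all monopole-dimer configurations. *)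

theory Defs
  imports "HOL-Analysis.Analysis" "HOL-Computational_Algebra.Polynomial"
begin

section \<open>The monopole-dimer model on a straight-line plane graph\<close>

text \<open>
  A graph is given by its vertex set \<open>V\<close>, its set \<open>E\<close> of two-element edges, and the position
  \<open>pos v\<close> of each vertex in the plane; an edge is drawn as the segment between its endpoints.

  A directed loop is encoded as its set of arcs. The cyclic sequence \<open>xs\<close> is determined by its arcs
  up to rotation, so a simple cycle of length at least 3 yields two directed loops. For \<open>xs = [u, v]\<close>
  the arcs are \<open>(u, v)\<close> and \<open>(v, u)\<close>: this is the doubled edge, and both orders of the endpoints
  yield the same set.
\<close>

definition cyclic_arcs :: "'v list \<Rightarrow> ('v \<times> 'v) set" where
  "cyclic_arcs xs = {(xs ! i, xs ! (Suc i mod length xs)) | i. i < length xs}"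

definition even_loops :: "'v set \<Rightarrow> 'v set set \<Rightarrow> ('v \<times> 'v) set set" where
  "even_loops V E =
    {cyclic_arcs xs | xs. distinct xs \<and> set xs \<subseteq> V \<and> even (length xs) \<and> 2 \<le> length xs \<and>
       (\<forall>(u, v) \<in> cyclic_arcs xs. {u, v} \<in> E)}"

definition loop_vertices :: "('v \<times> 'v) set \<Rightarrow> 'v set" where
  "loop_vertices l = fst ` l"

definition loop_curve :: "('v \<Rightarrow> complex) \<Rightarrow> ('v \<times> 'v) set \<Rightarrow> complex set" where
  "loop_curve pos l = (\<Union>(u, v) \<in> l. closed_segment (pos u) (pos v))"

text \<open>
  The library's \<open>inside S\<close> consists of the points off \<open>S\<close> lying in a bounded component of the
  complement of \<open>S\<close>. It is empty if \<open>S\<close> is a segment, so a doubled edge encloses no vertex.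
\<close>

definition enclosed_vertices ::
    "'v set \<Rightarrow> ('v \<Rightarrow> complex) \<Rightarrow> ('v \<times> 'v) set \<Rightarrow> 'v set" where
  "enclosed_vertices V pos l = {v \<in> V. pos v \<in> inside (loop_curve pos l)}"

definition monopole_dimer_configs :: "'v set \<Rightarrow> 'v set set \<Rightarrow> ('v \<times> 'v) set set set" where
  "monopole_dimer_configs V E =
    {C. C \<subseteq> even_loops V E \<and> pairwise (\<lambda>l l'. disjnt (loop_vertices l) (loop_vertices l')) C}"

definition monopoles :: "'v set \<Rightarrow> ('v \<times> 'v) set set \<Rightarrow> 'v set" where
  "monopoles V C = V - (\<Union>l \<in> C. loop_vertices l)"

text \<open>A doubled edge has two arcs, so the product over arcs gives the square of the edge weight.\<close>

definition loop_weight ::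
    "'v set \<Rightarrow> ('v \<Rightarrow> complex) \<Rightarrow> ('v set \<Rightarrow> 'r::comm_ring_1) \<Rightarrow> ('v \<times> 'v) set \<Rightarrow> 'r" where
  "loop_weight V pos ew l =
    (- 1) ^ card (enclosed_vertices V pos l) * (\<Prod>(u, v) \<in> l. ew {u, v})"

definition config_weight ::
    "'v set \<Rightarrow> ('v \<Rightarrow> complex) \<Rightarrow> ('v set \<Rightarrow> 'r::comm_ring_1) \<Rightarrow> ('v \<Rightarrow> 'r) \<Rightarrow>
      ('v \<times> 'v) set set \<Rightarrow> 'r" where
  "config_weight V pos ew vw C =
    (\<Prod>l \<in> C. loop_weight V pos ew l) * (\<Prod>v \<in> monopoles V C. vw v)"

definition partition_function ::
    "'v set \<Rightarrow> 'v set set \<Rightarrow> ('v \<Rightarrow> complex) \<Rightarrow> ('v set \<Rightarrow> 'r::comm_ring_1) \<Rightarrow> ('v \<Rightarrow> 'r) \<Rightarrow> 'r" where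
  "partition_function V E pos ew vw =
    (\<Sum>C \<in> monopole_dimer_configs V E. config_weight V pos ew vw C)"


section \<open>The grid graph\<close>

definition grid_vertices :: "nat \<Rightarrow> nat \<Rightarrow> (nat \<times> nat) set" where
  "grid_vertices m n = {1..m} \<times> {1..n}"

definition grid_a_edges :: "nat \<Rightarrow> nat \<Rightarrow> (nat \<times> nat) set set" where
  "grid_a_edges m n = {{(i, j), (i, j + 1)} | i j. 1 \<le> i \<and> i \<le> m \<and> 1 \<le> j \<and> j + 1 \<le> n}"

definition grid_b_edges :: "nat \<Rightarrow> nat \<Rightarrow> (nat \<times> nat) set set" where
  "grid_b_edges m n = {{(i, j), (i + 1, j)} | i j. 1 \<le> i \<and> i + 1 \<le> m \<and> 1 \<le> j \<and> j \<le> n}"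

definition grid_pos :: "nat \<times> nat \<Rightarrow> complex" where
  "grid_pos = (\<lambda>(i, j). Complex (real i) (real j))"

definition grid_Z :: "nat \<Rightarrow> nat \<Rightarrow> 'r::comm_ring_1 \<Rightarrow> 'r \<Rightarrow> 'r \<Rightarrow> 'r" where
  "grid_Z m n a b z =
    partition_function (grid_vertices m n) (grid_a_edges m n \<union> grid_b_edges m n) grid_pos
      (\<lambda>e. if e \<in> grid_a_edges m n then a else b) (\<lambda>_. z)"


section \<open>Polynomials in three indeterminates\<close>

text \<open>
  The polynomial ring in \<open>a\<close>, \<open>b\<close>, \<open>z\<close> over the integers is the iterated polynomial ring, with
  \<open>a\<close> the outermost and \<open>z\<close> the innermost variable.
\<close>

type_synonym poly3 = "int poly poly poly"

definition var_a :: poly3 where "var_a = [:0, 1:]"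
definition var_b :: poly3 where "var_b = [:[:0, 1:]:]"
definition var_z :: poly3 where "var_z = [:[:[:0, 1:]:]:]"

text \<open>The coefficient of the monomial with exponents \<open>i\<close>, \<open>j\<close>, \<open>k\<close> in \<open>a\<close>, \<open>b\<close>, \<open>z\<close>.\<close>

definition coeff3 :: "poly3 \<Rightarrow> nat \<Rightarrow> nat \<Rightarrow> nat \<Rightarrow> int" where
  "coeff3 P i j k = coeff (coeff (coeff P i) j) k"

end

theory Submission
  imports Defs "HOL-Complex_Analysis.Winding_Numbers" "HOL-Combinatorics.Cycles"
    "Jordan_Normal_Form.Determinant"
begin

text \<open>
  Orient the grid so that a directed cycle of length at least 4 enclosing \<open>N\<close> vertices has arc signs
  with product \<open>- (- 1) ^ N\<close>. Configurations are then the nonvanishing terms of a determinant \<open>det K\<close>,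
  with \<open>K = z + a D T - b T'\<close>, where \<open>T\<close> and \<open>T'\<close> are the skew-symmetric adjacency matrices of
  the paths in the two directions and the diagonal sign matrix \<open>D\<close> anticommutes with \<open>T'\<close>. Hence
  \<open>K K\<^sup>t = z\<^sup>2 + a\<^sup>2 T T\<^sup>t + b\<^sup>2 T' T'\<^sup>t\<close> has no mixed term. It only couples vertices whose
  coordinates have the same parities, and for even side lengths the reflections of the grid identify
  the four parity classes, so \<open>(det K)\<^sup>2 = Q\<^sup>4\<close> with \<open>Q\<close> the determinant of one class. Setting
  \<open>a = b = 0\<close> gives \<open>det K = Q\<^sup>2\<close>. One class is a weighted Laplacian plus a nonnegative diagonal,
  whose determinant has nonnegative coefficients.

  The sign of a cycle is a parity form of Pick's theorem. It comes from the argument in Hopf's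
  Umlaufsatz: for a simple closed walk \<open>x\<close> the secants \<open>x s - x t\<close> with \<open>s \<noteq> t\<close> avoid the origin,
  so the parity with which they cross a fixed ray can be moved through the \<open>(t, s)\<close>-plane.
\<close>

section \<open>Turning parity of closed lattice walks\<close>

text \<open>The exponent of a loop counts vertices by a topological condition, while a determinant
  only sees arcs. The bridge is a double product. Each grid vertex sends out a ray to the right, at
  half-integral height so that it meets no lattice point, and crossing signs are multiplied over all
  pairs of a grid vertex and an arc of the cycle. Grouped by vertices, a vertex off the cycle
  contributes -1 exactly if it is enclosed. Grouped by arcs, the product is local: a vertical arc in
  column \<open>i\<close> is met by the rays of the \<open>i - 1\<close> vertices to its left in one
  row, a horizontal arc by none. The obstacle is the vertices on the cycle itself, for which
  crossing parity has nothing to do with being enclosed. Their joint contribution has to be divided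
  out, and this is where the turning of the cycle enters: it makes that contribution minus a product
  of signs that depend only on the directions of the arcs. Both local factors together are the
  orientation of the grid.\<close>

text \<open>For lattice neighbours this is \<open>- 1\<close> iff the step crosses the ray \<open>{(x, 1/2) | x > 0}\<close>.\<close>

definition crossing :: "int \<times> int \<Rightarrow> int \<times> int \<Rightarrow> int" where
  "crossing p q = (if fst p > 0 \<and> snd p + snd q = 1 then - 1 else 1)"

definition unit_steps :: "(int \<times> int) set" where
  "unit_steps = {(1, 0), (0, 1), (- 1, 0), (0, - 1)}"

lemma crossing_squared [simp]: "crossing p q * crossing p q = 1"
  by (simp add: crossing_def)

lemma crossing_cases: "crossing p q = 1 \<or> crossing p q = - 1"
  by (simp add: crossing_def)

text \<open>The four secants are the corners of a unit cell, degenerate if \<open>f\<close> is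
  parallel to \<open>e\<close>. The only cell whose boundary crosses the ray an odd number of times
  is the one between (0, 0) and (1, 1), and it has the origin as a corner. So crossing parity is
  locally independent of the path as long as the secants do not vanish.\<close>

lemma crossing_square:
  assumes "e \<in> unit_steps" "f \<in> unit_steps"
    and "p \<noteq> 0" "p + e \<noteq> 0" "p - f \<noteq> 0" "p + e - f \<noteq> 0"
  shows "crossing p (p + e) * crossing (p - f) (p + e - f) =
    crossing p (p - f) * crossing (p + e) (p + e - f)"
proof -
  obtain i j where p: "p = (i, j)" by (cases p)
  have *: "d = (1, 0) \<or> d = (- 1, 0) \<or> d = (0, 1) \<or> d = (0, - 1)" if "d \<in> unit_steps" for d
    using that by (auto simp: unit_steps_def)
  show ?thesis
    using *[OF assms(1)]
  proof (elim disjE)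
    assume e: "e = (1, 0)"
    show ?thesis
      using *[OF assms(2)] assms(3-) unfolding p e
      by (elim disjE) (auto simp: crossing_def zero_prod_def)
  next
    assume e: "e = (- 1, 0)"
    show ?thesis
      using *[OF assms(2)] assms(3-) unfolding p e
      by (elim disjE) (auto simp: crossing_def zero_prod_def)
  next
    assume e: "e = (0, 1)"
    show ?thesis
      using *[OF assms(2)] assms(3-) unfolding p e
      by (elim disjE) (auto simp: crossing_def zero_prod_def)
  next
    assume e: "e = (0, - 1)"
    show ?thesis
      using *[OF assms(2)] assms(3-) unfolding p e
      by (elim disjE) (auto simp: crossing_def zero_prod_def)
  qed
qed

text \<open>The secant turns from a step \<open>p\<close> to the next step \<open>q\<close> by a
  detour over the two-step secant \<open>p + q\<close>, which is nonzero if the walk does not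
  backtrack. The sign tells whether the detour crosses the ray; multiplied around a closed walk it
  is a turning parity.\<close>

definition corner_sign :: "int \<times> int \<Rightarrow> int \<times> int \<Rightarrow> int" where
  "corner_sign p q = crossing p (p + q) * crossing (p + q) q"

lemma corner_sign_squared: "corner_sign p q * corner_sign p q = 1"
proof -
  have "corner_sign p q * corner_sign p q =
    (crossing p (p + q) * crossing p (p + q)) * (crossing (p + q) q * crossing (p + q) q)"
    by (simp only: corner_sign_def ac_simps)
  then show ?thesis by (simp only: crossing_squared mult_1_right)
qed

text \<open>The part of the orientation that depends on direction only. Opposite unit steps get
  opposite signs, as a doubled edge requires.\<close>

definition orientation_sign :: "int \<times> int \<Rightarrow> int" where
  "orientation_sign d = (if d = (1, 0) \<or> d = (0, - 1) then - 1 else 1)"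

text \<open>
  This is \<open>- 1\<close> iff the counterclockwise rotation from an outgoing step \<open>q\<close> to the reversed incoming
  step \<open>- p\<close> passes the ray of \<open>crossing\<close>. The displayed form is the one that telescopes around a cycle.
\<close>

definition sector_sign :: "int \<times> int \<Rightarrow> int \<times> int \<Rightarrow> int" where
  "sector_sign p q = (if p = (- 1, 0) \<and> q = (0, - 1) \<or> p = (0, - 1) \<and> q = (- 1, 0) then - orientation_sign q else orientation_sign q)"

definition side_sign :: "int \<times> int \<Rightarrow> int" where
  "side_sign d = (if d = (0, 1) \<or> d = (- 1, 0) then - 1 else 1)"

text \<open>This evaluates the ends of the strip between the views from two neighbouring vertices:
  \<open>q\<close> joins the vertices, \<open>p\<close> precedes it and \<open>r\<close> follows it.
  It is a finite check over triples without backtracking.\<close>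

lemma corner_turn:
  assumes "p \<in> unit_steps" "q \<in> unit_steps" "r \<in> unit_steps" "q \<noteq> - p" "r \<noteq> - q"
  shows "corner_sign q r * (crossing (- q - p) (- q) * crossing (- p) (- p - q)) =
    sector_sign p q * sector_sign q r"
  using assms unfolding unit_steps_def
  unfolding insert_iff empty_iff simp_thms
  by (elim disjE; hypsubst;
      simp add: crossing_def corner_sign_def orientation_sign_def sector_sign_def)

text \<open>Around a closed walk each step is once incoming and once outgoing, so the
  \<open>side_sign\<close> factors square away and the product of the sector signs becomes the
  orientation signs times the turning parity.\<close>

lemma sector_sign_eq:
  assumes "p \<in> unit_steps" "q \<in> unit_steps" "q \<noteq> - p"
  shows "sector_sign p q = orientation_sign q * corner_sign p q * (side_sign p * side_sign q)"
  using assms unfolding unit_steps_def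
  unfolding insert_iff empty_iff simp_thms
  by (elim disjE; hypsubst;
      simp add: crossing_def corner_sign_def orientation_sign_def sector_sign_def side_sign_def)

lemma prod_periodic_shift:
  fixes f :: "nat \<Rightarrow> 'a :: comm_monoid_mult"
  assumes "\<And>t. f (t + L) = f t"
  shows "(\<Prod>t\<in>{k..<k + L}. f t) = (\<Prod>t<L. f t)"
proof (induction k)
  case 0
  show ?case by (simp add: lessThan_atLeast0)
next
  case (Suc k)
  show ?case
  proof (cases "L = 0")
    case False
    then have "(\<Prod>t\<in>{Suc k..<Suc k + L}. f t) = (\<Prod>t\<in>{Suc k..<k + L}. f t) * f (k + L)"
      by (simp add: prod.atLeastLessThan_Suc)
    also have "\<dots> = (\<Prod>t\<in>{k..<k + L}. f t)"
      using False assms by (subst (2) prod.atLeast_Suc_lessThan) (auto simp: mult.commute)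
    finally show ?thesis using Suc by simp
  qed simp
qed

lemma prod_periodic_shift':
  fixes f :: "nat \<Rightarrow> 'a :: comm_monoid_mult"
  assumes "\<And>t. f (t + L) = f t"
  shows "(\<Prod>t<L. f (t + k)) = (\<Prod>t<L. f t)"
proof -
  have "(\<Prod>t<L. f (t + k)) = (\<Prod>t\<in>{k..<k + L}. f t)"
    using prod.shift_bounds_nat_ivl[of f 0 k L] by (simp add: lessThan_atLeast0 add.commute)
  then show ?thesis using prod_periodic_shift[of f, OF assms] by simp
qed

section \<open>Secants of a simple closed lattice walk\<close>

locale lattice_cycle =
  fixes x :: "nat \<Rightarrow> int \<times> int" and L :: nat
  assumes length_ge: "3 \<le> L"
    and periodic: "x (t + L) = x t"
    and step: "x (Suc t) - x t \<in> unit_steps"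
    and simple: "s < t \<Longrightarrow> t < s + L \<Longrightarrow> x s \<noteq> x t"
begin

definition D where "D t s = x s - x t"
definition d where "d t = x (Suc t) - x t"
text \<open>With the secants arranged in the \<open>(t, s)\<close>-plane, this is the crossing
  parity along a segment of fixed base \<open>x t\<close>. Indices may run past \<open>L\<close>
  because the walk is periodic, which avoids reduction modulo \<open>L\<close>.\<close>

definition row where "row t a b = (\<Prod>s\<in>{a..<b}. crossing (D t s) (D t (Suc s)))"

lemma d_unit: "d t \<in> unit_steps" unfolding d_def by (rule step)

lemma d_periodic: "d (t + L) = d t"
  using periodic[of t] periodic[of "Suc t"] by (simp add: d_def)

lemma corner_periodic: "corner_sign (d (t + L)) (d (Suc (t + L))) = corner_sign (d t) (d (Suc t))"
  using d_periodic[of t] d_periodic[of "Suc t"] by simp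

lemma D_nonzero: "s < t \<Longrightarrow> t < s + L \<Longrightarrow> D s t \<noteq> 0"
  using simple[of s t] by (simp add: D_def)

lemma D_Suc_right: "D t (Suc s) = D t s + d s" by (simp add: D_def d_def)
lemma D_Suc_left: "D (Suc t) s = D t s - d t" by (simp add: D_def d_def)
lemma D_self: "D t t = 0" by (simp add: D_def)

lemma no_backtrack: "d (Suc t) \<noteq> - d t"
proof
  assume "d (Suc t) = - d t"
  then have "D t (Suc (Suc t)) = 0" by (simp add: D_Suc_right D_self)
  then show False using D_nonzero[of t "Suc (Suc t)"] length_ge by auto
qed

text \<open>Every unit cell between the two rows has trivial product by
  \<open>crossing_square\<close>, and sides shared by neighbouring cells cancel, so only the
  boundary of the strip remains. The index bounds keep all its secants nonzero.\<close>

lemma strip: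
  assumes "Suc t < a" "a \<le> b" "b < t + L"
  shows "row t a b * row (Suc t) a b = crossing (D t a) (D (Suc t) a) * crossing (D t b) (D (Suc t) b)"
  using assms(2,3)
proof (induction b rule: dec_induct)
  case base
  then show ?case by (simp add: row_def)
next
  case (step b)
  have *: "crossing (D t b) (D t (Suc b)) * crossing (D (Suc t) b) (D (Suc t) (Suc b)) =
     crossing (D t b) (D (Suc t) b) * crossing (D t (Suc b)) (D (Suc t) (Suc b))"
    using crossing_square[of "d b" "d t" "D t b"]
      D_nonzero[of t b] D_nonzero[of t "Suc b"] D_nonzero[of "Suc t" b] D_nonzero[of "Suc t" "Suc b"]
      step assms(1)
    by (simp add: D_Suc_right D_Suc_left d_unit algebra_simps)
  have "row t a (Suc b) * row (Suc t) a (Suc b) = (row t a b * row (Suc t) a b) *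
      (crossing (D t b) (D t (Suc b)) * crossing (D (Suc t) b) (D (Suc t) (Suc b)))"
    using step by (simp add: row_def prod.atLeastLessThan_Suc ac_simps)
  also have "\<dots> = crossing (D t a) (D (Suc t) a) * (crossing (D t b) (D (Suc t) b) *
      crossing (D t b) (D (Suc t) b)) * crossing (D t (Suc b)) (D (Suc t) (Suc b))"
    unfolding * using step by (simp add: ac_simps)
  finally show ?case by simp
qed

lemma row_first: "a < b \<Longrightarrow> row t a b = crossing (D t a) (D t (Suc a)) * row t (Suc a) b"
  by (simp add: row_def prod.atLeast_Suc_lessThan)

lemma row_last: "a \<le> b \<Longrightarrow> row t a (Suc b) = row t a b * crossing (D t b) (D t (Suc b))"
  by (simp add: row_def prod.atLeastLessThan_Suc)

lemma row_squared: "row t a b * row t a b = 1"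
  by (simp add: row_def flip: prod.distrib)

lemma corner_sign_D:
  "corner_sign (d t) (d (Suc t)) =
     crossing (D t (Suc t)) (D t (Suc (Suc t))) * crossing (D t (Suc (Suc t))) (D (Suc t) (Suc (Suc t)))"
  by (simp add: corner_sign_def D_Suc_right D_Suc_left D_self)

text \<open>The view from \<open>x t\<close> of the whole walk except the two steps that touch
  \<open>x t\<close>.\<close>

definition full_row where "full_row t = row t (Suc t) (t + L - 1)"

lemma D_prev: "D t (t + L - 1) = - d (t + L - 1)"
  using periodic[of t] length_ge by (simp add: D_def d_def)

text \<open>When the viewpoint moves along one step, the bulk of the two views is compared by
  \<open>strip\<close>. What is left sits at the two ends and involves only three consecutive
  steps.\<close>

lemma full_row_Suc:
  "full_row t * full_row (Suc t) = sector_sign (d (t + L - 1)) (d t) * sector_sign (d t) (d (Suc t))"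
proof -
  let ?u = "t + L - 1"
  have L: "Suc ?u = t + L" "Suc t < ?u" using length_ge by auto
  have s: "row t (Suc (Suc t)) ?u * row (Suc t) (Suc (Suc t)) ?u =
    crossing (D t (Suc (Suc t))) (D (Suc t) (Suc (Suc t))) * crossing (D t ?u) (D (Suc t) ?u)"
    by (rule strip) (use L in auto)
  have "full_row t * full_row (Suc t) =
     crossing (D t (Suc t)) (D t (Suc (Suc t))) * row t (Suc (Suc t)) ?u *
     (row (Suc t) (Suc (Suc t)) ?u * crossing (D (Suc t) ?u) (D (Suc t) (Suc ?u)))"
    using row_first[of "Suc t" ?u t] row_last[of "Suc (Suc t)" ?u "Suc t"] L
    by (simp add: full_row_def)
  also have "\<dots> = corner_sign (d t) (d (Suc t)) *
      (crossing (D (Suc t) ?u) (D (Suc t) (Suc ?u)) * crossing (D t ?u) (D (Suc t) ?u))"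
    using s unfolding corner_sign_D by (simp add: ac_simps)
  also have "\<dots> = corner_sign (d t) (d (Suc t)) *
      (crossing (- d t - d ?u) (- d t) * crossing (- d ?u) (- d ?u - d t))"
  proof -
    have "D t ?u = - d ?u" by (rule D_prev)
    moreover from this have "D (Suc t) ?u = - d ?u - d t" by (simp add: D_Suc_left)
    moreover have "D (Suc t) (Suc ?u) = - d t" using L periodic[of t] by (simp add: D_def d_def)
    moreover have "- d t - d ?u = - d ?u - d t" by simp
    ultimately show ?thesis by (simp only:)
  qed
  also have "\<dots> = sector_sign (d ?u) (d t) * sector_sign (d t) (d (Suc t))"
    using no_backtrack[of ?u] no_backtrack[of t] L d_periodic[of t]
    by (intro corner_turn d_unit) auto
  finally show ?thesis .
qed

lemma sector_sign_squared: "sector_sign p q * sector_sign p q = 1"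
  by (simp add: sector_sign_def orientation_sign_def)

text \<open>The walk meets the ray from one of its vertices an odd number of times exactly if the
  ray starts into the interior angle there. \<open>sector_sign\<close> tests the angle to the left
  of the walk, which is interior at all vertices or at none. So the two signs have a constant ratio,
  the sense of traversal.\<close>

lemma full_row_const:
  "full_row t * sector_sign (d (t + L - 1)) (d t) = full_row 0 * sector_sign (d (L - 1)) (d 0)"
proof (induction t)
  case (Suc t)
  have "full_row t * full_row (Suc t) * (full_row t * sector_sign (d t) (d (Suc t))) =
     sector_sign (d (t + L - 1)) (d t) * sector_sign (d t) (d (Suc t)) *
       (full_row t * sector_sign (d t) (d (Suc t)))"
    by (simp add: full_row_Suc)
  then have "(full_row t * full_row t) * (full_row (Suc t) * sector_sign (d t) (d (Suc t))) =
     (sector_sign (d t) (d (Suc t)) * sector_sign (d t) (d (Suc t))) *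
       (full_row t * sector_sign (d (t + L - 1)) (d t))"
    by (simp only: ac_simps)
  then have "full_row (Suc t) * sector_sign (d t) (d (Suc t)) =
     full_row t * sector_sign (d (t + L - 1)) (d t)"
    by (simp add: full_row_def row_squared sector_sign_squared)
  moreover have "d (Suc t + L - 1) = d t" using d_periodic[of t] by simp
  ultimately show ?case using Suc by simp
qed simp

lemma prod_full_row:
  assumes "even L"
  shows "(\<Prod>t<L. full_row t) = (\<Prod>t<L. sector_sign (d (t + L - 1)) (d t))"
proof -
  let ?I = "\<lambda>t. sector_sign (d (t + L - 1)) (d t)" and ?c = "full_row 0 * sector_sign (d (L - 1)) (d 0)"
  have row_eq: "full_row t = ?c * ?I t" for t
  proof -
    have "full_row t = (full_row t * ?I t) * ?I t" by (simp only: mult.assoc sector_sign_squared mult_1_right)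
    also have "full_row t * ?I t = ?c" by (rule full_row_const)
    finally show ?thesis .
  qed
  have "(\<Prod>t<L. full_row t) = (\<Prod>t<L. ?c * ?I t)" by (rule prod.cong[OF refl]) (rule row_eq)
  also have "\<dots> = ?c ^ L * (\<Prod>t<L. ?I t)" by (simp only: prod.distrib prod_constant card_lessThan power_mult_distrib)
  \<comment> \<open>The sense of traversal enters once per vertex, so an even length removes
    it.\<close>
  also have "?c ^ L = 1"
  proof -
    have "?c * ?c = (full_row 0 * full_row 0) * (sector_sign (d (L - 1)) (d 0) * sector_sign (d (L - 1)) (d 0))"
      by (simp only: ac_simps)
    then have "?c ^ 2 = 1" by (simp only: full_row_def row_squared sector_sign_squared power2_eq_square mult_1_right)
    moreover obtain k where "L = 2 * k" using assms by (rule evenE)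
    ultimately show ?thesis by (simp only: power_mult power_one)
  qed
  finally show ?thesis by simp
qed


section \<open>The turning parity, seen from a topmost vertex\<close>

lemma row_first_from_top:
  assumes top: "\<And>t. snd (x t) < snd (x 0) \<or> snd (x t) = snd (x 0) \<and> fst (x t) \<le> fst (x 0)"
  shows "crossing (D 0 s) (D 0 (Suc s)) = 1"
  using top[of s] top[of "Suc s"] by (auto simp: crossing_def D_def)

text \<open>Every nonzero secant that ends at a topmost vertex, rightmost among these, lies in this
  half-plane.\<close>

definition upper :: "int \<times> int \<Rightarrow> bool" where
  "upper p \<longleftrightarrow> snd p > 0 \<or> snd p = 0 \<and> fst p > 0"

definition axis_sign :: "int \<times> int \<Rightarrow> int" where
  "axis_sign p = (if snd p = 0 then - 1 else 1)"

text \<open>Within the half-plane a unit step crosses the ray exactly when it enters or leaves the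
  axis. So the crossing sign is a coboundary there, and its product along a path depends only on the
  ends.\<close>

lemma crossing_upper:
  assumes "e \<in> unit_steps" "upper p" "upper (p - e)"
  shows "crossing p (p - e) = axis_sign p * axis_sign (p - e)"
  using assms unfolding unit_steps_def upper_def axis_sign_def crossing_def
  by (cases p) auto

lemma telescope_signs:
  fixes h :: "nat \<Rightarrow> int"
  assumes "a \<le> b" "\<And>t. h t * h t = 1"
  shows "(\<Prod>t\<in>{a..<b}. h t * h (Suc t)) = h a * h b"
  using assms(1)
proof (induction b rule: dec_induct)
  case base
  then show ?case by (simp add: assms(2))
next
  case (step b)
  then have "(\<Prod>t\<in>{a..<Suc b}. h t * h (Suc t)) = h a * (h b * h b) * h (Suc b)"
    by (simp add: prod.atLeastLessThan_Suc ac_simps)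
  then show ?case by (simp add: assms(2))
qed

text \<open>
  Hopf's argument: the boundary of the triangle \<open>0 \<le> t < s \<le> L\<close> has even crossing number. Seen from a
  topmost vertex \<open>x 0\<close>, the secants along \<open>t = 0\<close> miss the ray and those along \<open>s = L\<close> cross it once,
  so the diagonal, where the secants follow the steps, has odd crossing number.
\<close>

lemma turning_parity_from_top:
  assumes top: "\<And>t. snd (x t) < snd (x 0) \<or> snd (x t) = snd (x 0) \<and> fst (x t) \<le> fst (x 0)"
  shows "(\<Prod>t<L. corner_sign (d t) (d (Suc t))) = - 1"
proof -
  let ?c = "\<lambda>t. corner_sign (d t) (d (Suc t))"
  let ?v = "\<lambda>t. crossing (D t L) (D (Suc t) L)"
  let ?h = "\<lambda>t. axis_sign (D t L)"
  define M where "M = L - 1"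
  have L: "L = Suc M" "2 \<le> M" using length_ge by (auto simp: M_def)
  have xL: "x L = x 0" "d L = d 0" using periodic[of 0] d_periodic[of 0] by auto
  have up: "upper (D t L)" if "0 < t" "t < L" for t
    using top[of t] simple[of 0 t] that xL by (auto simp: upper_def D_def prod_eq_iff)
  have h2: "?h t * ?h t = 1" for t by (simp add: axis_sign_def)
  have ends: "D 1 L = - d 0" "D M L = d M" using xL L by (auto simp: D_def d_def)
  have u0: "upper (- d 0)" "upper (d M)" using up[of 1] up[of M] L ends by auto
  have nb: "d 0 \<noteq> - d M" using no_backtrack[of M] xL L by simp
  have v: "(\<Prod>t\<in>{1..<M}. ?v t) = - 1"
  proof -
    have "(\<Prod>t\<in>{1..<M}. ?v t) = (\<Prod>t\<in>{1..<M}. ?h t * ?h (Suc t))"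
    proof (rule prod.cong)
      fix t assume t: "t \<in> {1..<M}"
      then show "?v t = ?h t * ?h (Suc t)"
        using up[of t] up[of "Suc t"] L crossing_upper[of "d t" "D t L"]
        by (simp add: D_Suc_left d_unit)
    qed simp
    also have "\<dots> = ?h 1 * ?h M" using L by (intro telescope_signs h2) auto
    \<comment> \<open>The incoming step \<open>d M\<close> and the reversed outgoing step
      \<open>- d 0\<close> are distinct unit vectors in the half-plane, so they are (1, 0) and (0,
      1) in some order, and exactly one lies on the axis.\<close>
    also have "\<dots> = - 1"
      unfolding ends using u0 nb d_unit[of 0] d_unit[of M]
      by (auto simp: upper_def axis_sign_def unit_steps_def)
    finally show ?thesis .
  qed
  \<comment> \<open>The row \<open>t = 1\<close> is pushed through the triangle, one strip at a
    time, onto the diagonal and the side \<open>s = L\<close>.\<close>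
  have H: "row 1 2 L = (\<Prod>t\<in>{1..<k}. ?c t * ?v t) * row k (Suc k) L" if "1 \<le> k" "k \<le> M" for k
    using that
  proof (induction k rule: dec_induct)
    case base
    then show ?case by (simp add: numeral_2_eq_2)
  next
    case (step k)
    have "row k (Suc k) L * row (Suc k) (Suc (Suc k)) L = crossing (D k (Suc k)) (D k (Suc (Suc k))) *
       (row k (Suc (Suc k)) L * row (Suc k) (Suc (Suc k)) L)"
      using step L row_first[of "Suc k" L k] by simp
    also have "\<dots> = ?c k * ?v k"
      using strip[of k "Suc (Suc k)" L] step L unfolding corner_sign_D by simp
    finally have "row k (Suc k) L * row (Suc k) (Suc (Suc k)) L * row (Suc k) (Suc (Suc k)) L =
       ?c k * ?v k * row (Suc k) (Suc (Suc k)) L" by simp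
    then have "row k (Suc k) L = ?c k * ?v k * row (Suc k) (Suc (Suc k)) L"
      by (simp only: mult.assoc row_squared mult_1_right)
    with step show ?case by (simp add: prod.atLeastLessThan_Suc ac_simps)
  qed
  have H1: "row 1 2 L = - (\<Prod>t\<in>{1..<M}. ?c t)"
    using H[of M] L v by (simp add: row_def prod.distrib)
  have row0: "row 0 a b = 1" for a b
    by (simp add: row_def row_first_from_top[OF top])
  \<comment> \<open>The strip next to \<open>t = 0\<close> must stop at \<open>M = L - 1\<close>,
    since \<open>D 0 L\<close> vanishes; the corner beyond it is evaluated separately.\<close>
  have "row 1 2 M = crossing (D 0 2) (D 1 2) * crossing (D 0 M) (D 1 M)"
    using strip[of 0 2 M] row0 L by simp
  moreover have "?c 0 = crossing (D 0 2) (D 1 2)"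
    using row_first_from_top[OF top, of 1] unfolding corner_sign_D by (simp add: numeral_2_eq_2)
  ultimately have "row 1 2 L = ?c 0 * (crossing (D 0 M) (D 1 M) * crossing (D 1 M) (D 1 L))"
    using row_last[of 2 M 1] L by (simp add: ac_simps)
  also have "crossing (D 0 M) (D 1 M) * crossing (D 1 M) (D 1 L) = 1"
  proof -
    have "D 0 M = - d M" using L xL by (simp add: D_def d_def)
    then have "D 0 M = - d M" "D 1 M = - d M - d 0" using D_Suc_left[of 0 M] by auto
    then show ?thesis
      unfolding ends using u0 nb d_unit[of 0] d_unit[of M]
      by (auto simp: upper_def unit_steps_def crossing_def)
  qed
  finally have "?c 0 = - (\<Prod>t\<in>{1..<M}. ?c t)" using H1 by simp
  \<comment> \<open>At the topmost vertex the walk turns from (1, 0) to (0, -1) or from (0, 1) to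
    (-1, 0), away from the ray.\<close>
  moreover have "?c M = 1"
    using u0 nb d_unit[of 0] d_unit[of M] xL L
    by (auto simp: upper_def unit_steps_def crossing_def corner_sign_def)
  moreover have "?c 0 * ?c 0 = 1" by (rule corner_sign_squared)
  moreover have "(\<Prod>t<L. ?c t) = ?c 0 * (\<Prod>t\<in>{1..<M}. ?c t) * ?c M"
    using L by (simp add: lessThan_atLeast0 prod.atLeastLessThan_Suc prod.atLeast_Suc_lessThan)
  ultimately show ?thesis by simp
qed

lemma shifted: "lattice_cycle (\<lambda>t. x (t + k)) L"
proof
  show "x (t + L + k) = x (t + k)" for t using periodic[of "t + k"] by (simp add: ac_simps)
  show "x (Suc t + k) - x (t + k) \<in> unit_steps" for t using step[of "t + k"] by simp
  show "s < t \<Longrightarrow> t < s + L \<Longrightarrow> x (s + k) \<noteq> x (t + k)" for s t using simple[of "s + k" "t + k"] by simp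
qed (rule length_ge)

lemma periodic_mod: "x (t mod L) = x t"
proof -
  have "x (s + k * L) = x s" for s k
  proof (induction k)
    case (Suc k)
    have "x (s + Suc k * L) = x ((s + k * L) + L)" by (simp add: ac_simps)
    with Suc show ?case by (simp only: periodic)
  qed simp
  from this[of "t mod L" "t div L"] show ?thesis by simp
qed

text \<open>The product does not depend on the starting index, so the walk may start at a topmost
  vertex, rightmost among these.\<close>

lemma turning_parity: "(\<Prod>t<L. corner_sign (d t) (d (Suc t))) = - 1"
proof -
  have fin: "finite (x ` {..<L})" "x ` {..<L} \<noteq> {}" using length_ge by (auto simp: lessThan_empty_iff)
  have rng: "x t \<in> x ` {..<L}" for t
  proof -
    have "t mod L \<in> {..<L}" using length_ge by simp
    then have "x (t mod L) \<in> x ` {..<L}" by (rule imageI)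
    then show ?thesis by (simp only: periodic_mod)
  qed
  define M where "M = Max (snd ` x ` {..<L})"
  define S where "S = {p \<in> x ` {..<L}. snd p = M}"
  have "M \<in> snd ` x ` {..<L}" unfolding M_def using fin by (intro Max_in) auto
  then obtain p where "p \<in> x ` {..<L}" "snd p = M" by blast
  then have "p \<in> S" unfolding S_def by blast
  then have S: "finite S" "S \<noteq> {}"
    using fin(1) finite_subset[of S "x ` {..<L}"] unfolding S_def by blast+
  have "Max (fst ` S) \<in> fst ` S" using S by (intro Max_in) auto
  then obtain q where q: "q \<in> S" "Max (fst ` S) = fst q" by blast
  then obtain k where "q = x k" unfolding S_def by blast
  with q have k: "x k \<in> S" "fst (x k) = Max (fst ` S)" by simp_all
  have top: "snd (x t) < snd (x k) \<or> snd (x t) = snd (x k) \<and> fst (x t) \<le> fst (x k)" for t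
  proof -
    have "snd (x t) \<le> M" unfolding M_def using fin rng[of t] by (intro Max_ge) auto
    moreover have "snd (x k) = M" using k by (simp add: S_def)
    moreover have "fst (x t) \<le> fst (x k)" if "snd (x t) = M"
      unfolding k(2) using S that rng[of t] by (intro Max_ge) (auto simp: S_def)
    ultimately show ?thesis by linarith
  qed
  interpret y: lattice_cycle "\<lambda>t. x (t + k)" L by (rule shifted)
  have yd: "y.d t = d (t + k)" for t by (simp add: y.d_def d_def)
  have "(\<Prod>t<L. corner_sign (d (t + k)) (d (Suc (t + k)))) = - 1"
  proof -
    have "snd (x (t + k)) < snd (x (0 + k)) \<or> snd (x (t + k)) = snd (x (0 + k)) \<and> fst (x (t + k)) \<le> fst (x (0 + k))" for t
      unfolding add_0 by (rule top)
    from y.turning_parity_from_top[OF this] show ?thesis by (simp only: yd add_Suc)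
  qed
  moreover have "(\<Prod>t<L. corner_sign (d (t + k)) (d (Suc (t + k)))) = (\<Prod>t<L. corner_sign (d t) (d (Suc t)))"
    by (rule prod_periodic_shift'[where f = "\<lambda>t. corner_sign (d t) (d (Suc t))"]) (rule corner_periodic)
  ultimately show ?thesis by simp
qed

section \<open>Crossing signs as seen from all vertices of the walk\<close>

lemma prod_crossing_row:
  "(\<Prod>s<L. crossing (D t s) (D t (Suc s))) = full_row t"
proof -
  let ?f = "\<lambda>s. crossing (D t s) (D t (Suc s))"
  let ?u = "t + L - 1"
  have L: "t < ?u" "t + L = Suc ?u" using length_ge by auto
  have per: "D t (s + L) = D t s" for s using periodic by (simp add: D_def)
  have f_per: "?f (s + L) = ?f s" for s using per[of s] per[of "Suc s"] by simp
  have "(\<Prod>s<L. ?f s) = (\<Prod>s\<in>{t..<t + L}. ?f s)"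
    by (rule prod_periodic_shift[symmetric]) (rule f_per)
  also have "{t..<t + L} = insert t (insert ?u {Suc t..<?u})" using L by auto
  also have "prod ?f \<dots> = ?f t * (?f ?u * prod ?f {Suc t..<?u})"
    using L(1) by (subst prod.insert; simp)
  also have "?f t = 1" by (simp add: crossing_def D_self)
  also have "?f ?u = 1"
  proof -
    have "D t (Suc ?u) = 0" using L per[of t] D_self by simp
    moreover have "D t ?u = - d ?u" by (rule D_prev)
    ultimately show ?thesis using d_unit[of ?u] by (auto simp: crossing_def unit_steps_def)
  qed
  finally show ?thesis by (simp add: full_row_def row_def)
qed

text \<open>This is the contribution of the vertices on the walk to the double product over vertices
  and arcs. Each viewpoint yields a sector sign up to the sense of traversal, and the minus sign is
  the turning parity contained in the sector signs.\<close>

theorem prod_crossing: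
  assumes "even L"
  shows "(\<Prod>t<L. \<Prod>s<L. crossing (x s - x t) (x (Suc s) - x t)) =
    - (\<Prod>t<L. orientation_sign (x (Suc t) - x t))"
proof -
  let ?p = "\<lambda>t. d (t + L - 1)"
  have p: "?p t = d (t + (L - 1))" "d (Suc (t + (L - 1))) = d t" for t
    using d_periodic[of t] length_ge by auto
  have nb: "d t \<noteq> - ?p t" for t using no_backtrack[of "t + (L - 1)"] p[of t] by simp
  have "(\<Prod>t<L. \<Prod>s<L. crossing (D t s) (D t (Suc s))) = (\<Prod>t<L. sector_sign (?p t) (d t))"
    using prod_full_row[OF assms] by (simp add: prod_crossing_row)
  also have "\<dots> = (\<Prod>t<L. orientation_sign (d t)) * (\<Prod>t<L. corner_sign (?p t) (d t)) *
      ((\<Prod>t<L. side_sign (?p t)) * (\<Prod>t<L. side_sign (d t)))"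
    by (simp only: sector_sign_eq[OF d_unit d_unit nb] prod.distrib)
  also have "(\<Prod>t<L. corner_sign (?p t) (d t)) =
      (\<Prod>t<L. corner_sign (d (t + (L - 1))) (d (Suc (t + (L - 1)))))"
    by (simp only: p)
  also have "\<dots> = (\<Prod>t<L. corner_sign (d t) (d (Suc t)))"
    by (rule prod_periodic_shift'[where f = "\<lambda>t. corner_sign (d t) (d (Suc t))"]) (rule corner_periodic)
  also have "\<dots> = - 1" by (rule turning_parity)
  also have "(\<Prod>t<L. side_sign (?p t)) = (\<Prod>t<L. side_sign (d t))"
    unfolding p by (rule prod_periodic_shift'[where f = "\<lambda>t. side_sign (d t)"]) (simp add: d_periodic)
  also have "(\<Prod>t<L. side_sign (d t)) * (\<Prod>t<L. side_sign (d t)) = 1"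
    by (subst prod.distrib[symmetric]) (auto simp: side_sign_def intro!: prod.neutral)
  finally show ?thesis by (simp add: D_def d_def)
qed

end

section \<open>Enclosed lattice points as crossing parities\<close>

definition lattice_point :: "int \<times> int \<Rightarrow> complex" where
  "lattice_point p = Complex (of_int (fst p)) (of_int (snd p))"

lemma lattice_point_inject: "lattice_point p = lattice_point q \<longleftrightarrow> p = q"
  by (auto simp: lattice_point_def prod_eq_iff)

lemma lattice_segment_cases:
  assumes "b - a \<in> unit_steps" "z \<in> closed_segment (lattice_point a) (lattice_point b)"
  obtains c where "{a, b} = {c, c + (1, 0)}" "Im z = of_int (snd c)"
      "of_int (fst c) \<le> Re z" "Re z \<le> of_int (fst c) + 1"
    | c where "{a, b} = {c, c + (0, 1)}" "Re z = of_int (fst c)"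
      "of_int (snd c) \<le> Im z" "Im z \<le> of_int (snd c) + 1"
proof -
  have "b = a + (1, 0) \<or> b = a + (0, 1) \<or> a = b + (1, 0) \<or> a = b + (0, 1)"
    using assms(1) by (cases a; cases b) (auto simp: unit_steps_def)
  then show ?thesis
  proof (elim disjE)
    assume b: "b = a + (1, 0)"
    show ?thesis
      by (rule that(1)[of a]) (use assms(2) in \<open>auto simp: b lattice_point_def closed_segment_same_Im closed_segment_eq_real_ivl\<close>)
  next
    assume b: "b = a + (0, 1)"
    show ?thesis
      by (rule that(2)[of a]) (use assms(2) in \<open>auto simp: b lattice_point_def closed_segment_same_Re closed_segment_eq_real_ivl\<close>)
  next
    assume b: "a = b + (1, 0)"
    show ?thesis
      by (rule that(1)[of b]) (use assms(2) in \<open>auto simp: b lattice_point_def closed_segment_same_Im closed_segment_eq_real_ivl\<close>)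
  next
    assume b: "a = b + (0, 1)"
    show ?thesis
      by (rule that(2)[of b]) (use assms(2) in \<open>auto simp: b lattice_point_def closed_segment_same_Re closed_segment_eq_real_ivl\<close>)
  qed
qed

lemma lattice_point_on_segment:
  assumes "b - a \<in> unit_steps" "lattice_point p \<in> closed_segment (lattice_point a) (lattice_point b)"
  shows "p = a \<or> p = b"
  using assms
proof (cases rule: lattice_segment_cases)
  case (1 c)
  then have "snd p = snd c" "fst c \<le> fst p" "fst p \<le> fst c + 1"
    unfolding lattice_point_def complex.sel by linarith+
  then have "p = c \<or> p = c + (1, 0)" unfolding prod_eq_iff fst_add snd_add fst_conv snd_conv by linarith
  with 1(1) show ?thesis by (auto simp: doubleton_eq_iff)
next
  case (2 c)
  then have "fst p = fst c" "snd c \<le> snd p" "snd p \<le> snd c + 1"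
    unfolding lattice_point_def complex.sel by linarith+
  then have "p = c \<or> p = c + (0, 1)" unfolding prod_eq_iff fst_add snd_add fst_conv snd_conv by linarith
  with 2(1) show ?thesis by (auto simp: doubleton_eq_iff)
qed

text \<open>At a point of an edge that is not a lattice point exactly one coordinate is fractional,
  so rounding down and up recovers both endpoints. Hence distinct edges can meet only in lattice
  points.\<close>

lemma lattice_segment_unique:
  assumes "b - a \<in> unit_steps" "z \<in> closed_segment (lattice_point a) (lattice_point b)"
    and "z \<notin> range lattice_point"
  shows "{a, b} = {(\<lfloor>Re z\<rfloor>, \<lfloor>Im z\<rfloor>), (\<lceil>Re z\<rceil>, \<lceil>Im z\<rceil>)}"
  using assms(1,2)
proof (cases rule: lattice_segment_cases)
  case (1 c)
  have "z \<noteq> lattice_point c" "z \<noteq> lattice_point (c + (1, 0))" using assms(3) by auto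
  then have "Re z \<noteq> of_int (fst c)" "Re z \<noteq> of_int (fst c) + 1"
    using 1 by (auto simp: lattice_point_def complex_eq_iff)
  then have "\<lfloor>Re z\<rfloor> = fst c" "\<lceil>Re z\<rceil> = fst c + 1"
    using 1 by (auto intro!: floor_unique ceiling_unique)
  then show ?thesis using 1 by (cases c) auto
next
  case (2 c)
  have "z \<noteq> lattice_point c" "z \<noteq> lattice_point (c + (0, 1))" using assms(3) by auto
  then have "Im z \<noteq> of_int (snd c)" "Im z \<noteq> of_int (snd c) + 1"
    using 2 by (auto simp: lattice_point_def complex_eq_iff)
  then have "\<lfloor>Im z\<rfloor> = snd c" "\<lceil>Im z\<rceil> = snd c + 1"
    using 2 by (auto intro!: floor_unique ceiling_unique)
  then show ?thesis using 2 by (cases c) auto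
qed

lemma lattice_segment_Int:
  assumes "b - a \<in> unit_steps" "d - c \<in> unit_steps" "{a, b} \<noteq> {c, d}"
    and "z \<in> closed_segment (lattice_point a) (lattice_point b)"
    and "z \<in> closed_segment (lattice_point c) (lattice_point d)"
  obtains p where "z = lattice_point p" "p \<in> {a, b}" "p \<in> {c, d}"
proof (cases "z \<in> range lattice_point")
  case True
  then obtain p where "z = lattice_point p" by blast
  with that assms show ?thesis using lattice_point_on_segment by blast
next
  case False
  with lattice_segment_unique assms show ?thesis by metis
qed

text \<open>Lattice points are shifted off the lattice so that no edge ends on the ray of \<open>crossing\<close>.\<close>

definition half_point :: "int \<times> int \<Rightarrow> complex" where
  "half_point v = Complex (of_int (fst v)) (of_int (snd v) + 1 / 2)"

text \<open>The shift by half a unit stays in one component of the complement of a cycle that avoids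
  \<open>v\<close>, so the winding number about \<open>v\<close> can be computed at the shifted
  point.\<close>

lemma segment_to_half_point_disjoint:
  assumes "b - a \<in> unit_steps" "v \<noteq> a" "v \<noteq> b"
  shows "closed_segment (lattice_point v) (half_point v) \<inter>
    closed_segment (lattice_point a) (lattice_point b) = {}"
proof (rule ccontr)
  assume "\<not> ?thesis"
  then obtain z where z: "z \<in> closed_segment (lattice_point v) (half_point v)"
    "z \<in> closed_segment (lattice_point a) (lattice_point b)" by blast
  then have v: "Re z = of_int (fst v)" "of_int (snd v) \<le> Im z" "Im z \<le> of_int (snd v) + 1 / 2"
    by (auto simp: lattice_point_def half_point_def closed_segment_same_Re closed_segment_eq_real_ivl)
  show False
  proof (cases "z \<in> range lattice_point")
    case True
    then obtain p where p: "z = lattice_point p" by blast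
    with v have "p = v" by (cases p; cases v) (auto simp: lattice_point_def)
    with p z(2) lattice_point_on_segment assms show False by blast
  next
    case False
    then have "\<lfloor>Im z\<rfloor> = snd v" using v by (intro floor_unique) auto
    moreover have "\<lfloor>Re z\<rfloor> = fst v" using v by simp
    ultimately have "v \<in> {a, b}" unfolding lattice_segment_unique[OF assms(1) z(2) False] by simp
    with assms show False by blast
  qed
qed

section \<open>Winding numbers of edges and crossings\<close>

definition parity_sign :: "int \<Rightarrow> int" where
  "parity_sign k = (if even k then 1 else - 1)"

text \<open>As a function of \<open>z\<close>, \<open>Ln (q - z)\<close> has its cut along the
  horizontal ray from \<open>q\<close> to the right. On an edge that misses the cut it is a
  primitive, and \<open>k = 0\<close>. On an edge that meets the cut, \<open>Ln (z - q)\<close> is a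
  primitive, and the comparison of the two branches gives \<open>k = 1\<close> or
  \<open>k = - 1\<close>. The logarithms of the first branch are kept because they telescope around
  a cycle.\<close>

lemma winding_number_lattice_segment:
  assumes "b - a \<in> unit_steps" "v \<noteq> a" "v \<noteq> b"
  defines "q \<equiv> half_point v"
  obtains k where "winding_number (linepath (lattice_point a) (lattice_point b)) q =
      (Ln (q - lattice_point b) - Ln (q - lattice_point a)) / (2 * pi * \<i>) + of_int k"
    and "parity_sign k = crossing (a - v) (b - v)"
proof -
  let ?g = "linepath (lattice_point a) (lattice_point b)"
  have img: "path_image ?g = closed_segment (lattice_point a) (lattice_point b)" by simp
  have q: "q \<notin> path_image ?g"
    using segment_to_half_point_disjoint[OF assms(1-3)] unfolding img q_def by auto
  have ne: "z - q \<noteq> 0" if "z \<in> path_image ?g" for z using that q by auto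
  have w: "winding_number ?g q = 1 / (2 * pi * \<i>) * contour_integral ?g (\<lambda>w. 1 / (w - q))"
    using q by (intro winding_number_valid_path) auto
  show ?thesis
  proof (cases "crossing (a - v) (b - v) = 1")
    case True
    \<comment> \<open>A point of the edge on the cut has half-integral height, so the edge is
      vertical. It lies strictly to the right of \<open>v\<close>, since \<open>v\<close> is not an
      endpoint, and would be a crossing.\<close>
    have nonpos: "q - z \<notin> \<real>\<^sub>\<le>\<^sub>0" if z: "z \<in> path_image ?g" for z
    proof
      assume "q - z \<in> \<real>\<^sub>\<le>\<^sub>0"
      then have z': "Im z = of_int (snd v) + 1 / 2" "of_int (fst v) \<le> Re z"
        by (auto simp: complex_nonpos_Reals_iff q_def half_point_def)
      have "z \<noteq> lattice_point p" for p
      proof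
        assume "z = lattice_point p"
        with z' have "real_of_int (2 * snd p) = real_of_int (2 * snd v + 1)" by (simp add: lattice_point_def)
        then have "2 * snd p = 2 * snd v + 1" by (simp only: of_int_eq_iff)
        then show False by presburger
      qed
      then have "z \<notin> range lattice_point" by blast
      from lattice_segment_unique[OF assms(1) _ this] z
      have ab: "{a, b} = {(\<lfloor>Re z\<rfloor>, \<lfloor>Im z\<rfloor>), (\<lceil>Re z\<rceil>, \<lceil>Im z\<rceil>)}" by simp
      have im: "\<lfloor>Im z\<rfloor> = snd v" "\<lceil>Im z\<rceil> = snd v + 1"
        using z' by (auto intro!: floor_unique ceiling_unique)
      have "v \<noteq> (\<lfloor>Re z\<rfloor>, snd v)" using ab im assms(2,3) by auto
      then have "fst v \<noteq> \<lfloor>Re z\<rfloor>" by (cases v) auto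
      moreover have "fst v \<le> \<lfloor>Re z\<rfloor>" using z' by (simp add: le_floor_iff)
      moreover have "\<lfloor>Re z\<rfloor> \<le> \<lceil>Re z\<rceil>" by (rule floor_le_ceiling)
      ultimately have "fst v < \<lfloor>Re z\<rfloor>" "fst v < \<lceil>Re z\<rceil>" by linarith+
      then have "crossing (a - v) (b - v) = - 1"
        using ab im by (auto simp: crossing_def doubleton_eq_iff)
      with True show False by simp
    qed
    have "((\<lambda>w. 1 / (w - q)) has_contour_integral
        (Ln (q - pathfinish ?g) - Ln (q - pathstart ?g))) ?g"
    proof (rule contour_integral_primitive[where S = "path_image ?g"])
      fix z assume z: "z \<in> path_image ?g"
      have "((\<lambda>z. Ln (q - z)) has_field_derivative 1 / (z - q)) (at z)"
        using nonpos[OF z] ne[OF z]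
        by (auto intro!: derivative_eq_intros simp: field_simps)
      then show "((\<lambda>z. Ln (q - z)) has_field_derivative 1 / (z - q)) (at z within path_image ?g)"
        by (rule has_field_derivative_at_within)
    qed auto
    then have "contour_integral ?g (\<lambda>w. 1 / (w - q)) = Ln (q - lattice_point b) - Ln (q - lattice_point a)"
      by (simp add: contour_integral_unique)
    with w True show ?thesis by (intro that[of 0]) (auto simp: parity_sign_def)
  next
    case False
    have "0 < fst (a - v) \<and> snd (a - v) + snd (b - v) = 1"
      using False unfolding crossing_def by argo
    then have c: "fst a > fst v" "snd a + snd b = 2 * snd v + 1" by auto
    have "b - a = (0, 1) \<or> b - a = (0, - 1)"
    proof -
      have "snd a + snd b = 2 * snd a + snd (b - a)" by simp
      then have "snd (b - a) \<noteq> 0" using c(2) by presburger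
      moreover have "e = (0, 1) \<or> e = (0, - 1)" if "e \<in> unit_steps" "snd e \<noteq> 0" for e
        using that by (auto simp: unit_steps_def)
      ultimately show ?thesis using assms(1) by blast
    qed
    moreover have "b = (b - a) + a" by simp
    ultimately have "b = (0, 1) + a \<or> b = (0, - 1) + a" by metis
    then have ab: "fst b = fst a" "snd a = snd v \<and> snd b = snd v + 1 \<or> snd b = snd v \<and> snd a = snd v + 1"
      using c(2) by auto
    have pos: "z - q \<notin> \<real>\<^sub>\<le>\<^sub>0" if z: "z \<in> path_image ?g" for z
    proof -
      have "Re z = of_int (fst a)" using z ab by (auto simp: lattice_point_def closed_segment_same_Re)
      with c show ?thesis by (auto simp: complex_nonpos_Reals_iff q_def half_point_def)
    qed
    have "((\<lambda>w. 1 / (w - q)) has_contour_integral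
        (Ln (pathfinish ?g - q) - Ln (pathstart ?g - q))) ?g"
    proof (rule contour_integral_primitive[where S = "path_image ?g"])
      fix z assume z: "z \<in> path_image ?g"
      have "((\<lambda>z. Ln (z - q)) has_field_derivative 1 / (z - q)) (at z)"
        using pos[OF z] ne[OF z]
        by (auto intro!: derivative_eq_intros simp: field_simps)
      then show "((\<lambda>z. Ln (z - q)) has_field_derivative 1 / (z - q)) (at z within path_image ?g)"
        by (rule has_field_derivative_at_within)
    qed auto
    then have i: "contour_integral ?g (\<lambda>w. 1 / (w - q)) = Ln (lattice_point b - q) - Ln (lattice_point a - q)"
      by (simp add: contour_integral_unique)
    have neq: "lattice_point a - q \<noteq> 0" "lattice_point b - q \<noteq> 0" using ne by auto
    \<comment> \<open>Passing from \<open>z - q\<close> to \<open>q - z\<close> shifts the logarithm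
      by half a turn, in opposite senses below and above the ray; the two shifts make up one full
      turn.\<close>
    have La: "Ln (q - lattice_point a) = (if snd a = snd v then Ln (lattice_point a - q) + \<i> * pi
        else Ln (lattice_point a - q) - \<i> * pi)"
      using Ln_minus[OF neq(1)] ab by (auto simp: q_def half_point_def lattice_point_def)
    have Lb: "Ln (q - lattice_point b) = (if snd b = snd v then Ln (lattice_point b - q) + \<i> * pi
        else Ln (lattice_point b - q) - \<i> * pi)"
      using Ln_minus[OF neq(2)] ab by (auto simp: q_def half_point_def lattice_point_def)
    have m: "crossing (a - v) (b - v) = - 1" using False crossing_cases by blast
    from ab(2) show ?thesis
    proof
      assume "snd a = snd v \<and> snd b = snd v + 1"
      with La Lb w i m show ?thesis
        by (intro that[of 1]) (auto simp: parity_sign_def field_simps)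
    next
      assume "snd b = snd v \<and> snd a = snd v + 1"
      with La Lb w i m show ?thesis
        by (intro that[of "- 1"]) (auto simp: parity_sign_def field_simps)
    qed
  qed
qed

lemma parity_sign_sum: "(\<Prod>s<n. parity_sign (k s)) = parity_sign (\<Sum>s<n. k s)" for n :: nat
  by (induction n) (auto simp: parity_sign_def)

section \<open>The walk as a simple closed polygon\<close>

context lattice_cycle
begin

definition P where "P t = lattice_point (x t)"

text \<open>\<open>polygon k\<close> has \<open>k + 1\<close> edges and ends in
  \<open>P (Suc k)\<close>: \<open>polygon (L - 2)\<close> is still an arc, and
  \<open>polygon (L - 1)\<close> closes it.\<close>

fun polygon :: "nat \<Rightarrow> real \<Rightarrow> complex" where
  "polygon 0 = linepath (P 0) (P 1)"
| "polygon (Suc k) = polygon k +++ linepath (P (Suc k)) (P (Suc (Suc k)))"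

lemma pathstart_polygon [simp]: "pathstart (polygon k) = P 0"
  by (induction k) auto

lemma pathfinish_polygon [simp]: "pathfinish (polygon k) = P (Suc k)"
  by (induction k) auto

lemma path_polygon [simp]: "path (polygon k)"
  by (induction k) auto

lemma path_image_polygon: "path_image (polygon k) = (\<Union>t\<le>k. closed_segment (P t) (P (Suc t)))"
  by (induction k) (auto simp: path_image_join atMost_Suc)

lemma P_distinct: "s < t \<Longrightarrow> t < s + L \<Longrightarrow> P s \<noteq> P t"
  using simple[of s t] by (simp add: P_def lattice_point_inject)

lemma segments_Int:
  assumes "s < t" "t < L" "z \<in> closed_segment (P s) (P (Suc s))" "z \<in> closed_segment (P t) (P (Suc t))"
  obtains p where "z = lattice_point p" "p \<in> {x s, x (Suc s)}" "p \<in> {x t, x (Suc t)}"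
proof -
  \<comment> \<open>Two edges with the same endpoints would be consecutive and opposite, a closed
    walk of length 2.\<close>
  have ne: "{x s, x (Suc s)} \<noteq> {x t, x (Suc t)}"
  proof
    assume eq: "{x s, x (Suc s)} = {x t, x (Suc t)}"
    have "x s \<noteq> x t" using simple[of s t] assms by simp
    with eq have e: "x s = x (Suc t)" "x (Suc s) = x t" by (auto simp: doubleton_eq_iff)
    then have "Suc s = t" using simple[of "Suc s" t] assms by (cases "Suc s = t") auto
    with e(1) show False using simple[of s "Suc t"] length_ge by auto
  qed
  show ?thesis
    using lattice_segment_Int[OF step[of s] step[of t] ne] assms that unfolding P_def by blast
qed

lemma arc_polygon: "k + 2 \<le> L \<Longrightarrow> k + 1 < L \<Longrightarrow> arc (polygon k)"
proof (induction k)
  case 0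
  then show ?case using P_distinct[of 0 1] by (auto intro: arc_linepath)
next
  case (Suc k)
  have "path_image (polygon k) \<inter> closed_segment (P (Suc k)) (P (Suc (Suc k))) \<subseteq> {P (Suc k)}"
  proof
    fix z assume "z \<in> path_image (polygon k) \<inter> closed_segment (P (Suc k)) (P (Suc (Suc k)))"
    then obtain t where t: "t \<le> k" "z \<in> closed_segment (P t) (P (Suc t))"
      "z \<in> closed_segment (P (Suc k)) (P (Suc (Suc k)))" by (auto simp: path_image_polygon)
    then obtain p where p: "z = lattice_point p" "p \<in> {x t, x (Suc t)}" "p \<in> {x (Suc k), x (Suc (Suc k))}"
      using segments_Int[of t "Suc k" z] Suc.prems by auto
    have "p \<noteq> x (Suc (Suc k))"
      using p(2) t(1) simple[of t "Suc (Suc k)"] simple[of "Suc t" "Suc (Suc k)"] Suc.prems by auto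
    with p show "z \<in> {P (Suc k)}" by (auto simp: P_def)
  qed
  moreover have "P (Suc k) \<noteq> P (Suc (Suc k))" using P_distinct[of "Suc k" "Suc (Suc k)"] length_ge by auto
  ultimately show ?case
    using Suc by (auto intro!: arc_join arc_linepath)
qed

lemma P_L: "P L = P 0" using periodic[of 0] by (simp add: P_def)

lemma simple_path_polygon: "simple_path (polygon (L - 1))"
proof -
  define k where "k = L - 2"
  have k: "L = Suc (Suc k)" "1 \<le> k" using length_ge by (auto simp: k_def)
  have "path_image (polygon k) \<inter> closed_segment (P (Suc k)) (P (Suc (Suc k))) \<subseteq> {P 0, P (Suc k)}"
  proof
    fix z assume "z \<in> path_image (polygon k) \<inter> closed_segment (P (Suc k)) (P (Suc (Suc k)))"
    then obtain t where t: "t \<le> k" "z \<in> closed_segment (P t) (P (Suc t))"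
      "z \<in> closed_segment (P (Suc k)) (P (Suc (Suc k)))" by (auto simp: path_image_polygon)
    obtain p where p: "z = lattice_point p" "p \<in> {x (Suc k), x (Suc (Suc k))}"
      by (rule segments_Int[of t "Suc k" z]) (use t k in auto)
    then show "z \<in> {P 0, P (Suc k)}" using P_L k by (auto simp: P_def)
  qed
  moreover have "P (Suc k) \<noteq> P (Suc (Suc k))" using P_distinct[of "Suc k" "Suc (Suc k)"] length_ge by auto
  moreover have "arc (polygon k)" using arc_polygon[of k] k by simp
  moreover have "L - 1 = Suc k" using k by simp
  moreover have "P (Suc (Suc k)) = P 0" using P_L k by simp
  ultimately show ?thesis
    by (auto intro!: simple_path_join_loop arc_linepath)
qed

lemma winding_number_polygon:
  assumes "q \<notin> path_image (polygon k)"
  shows "winding_number (polygon k) q = (\<Sum>t\<le>k. winding_number (linepath (P t) (P (Suc t))) q)"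
  using assms
proof (induction k)
  case (Suc k)
  then show ?case
    by (subst polygon.simps, subst winding_number_join) (auto simp: path_image_join)
qed simp

text \<open>Around the cycle the logarithms of the edges telescope to 0, so the winding number is
  the sum of the integers \<open>k\<close>, whose parity is the product of the crossing signs. For a
  simple closed curve the winding number is 1 or -1 inside and 0 outside, so its parity
  decides.\<close>

theorem inside_iff_crossing:
  assumes "v \<notin> range x"
  shows "lattice_point v \<in> inside (\<Union>t<L. closed_segment (P t) (P (Suc t))) \<longleftrightarrow>
    (\<Prod>s<L. crossing (x s - v) (x (Suc s) - v)) = - 1"
proof -
  let ?g = "polygon (L - 1)" and ?q = "half_point v"
  have L: "{..L - 1} = {..<L}" "Suc (L - 1) = L" using length_ge by auto
  have img: "path_image ?g = (\<Union>t<L. closed_segment (P t) (P (Suc t)))"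
    by (simp only: path_image_polygon L)
  have closed: "pathfinish ?g = pathstart ?g" by (simp only: pathstart_polygon pathfinish_polygon L P_L)
  have v: "v \<noteq> x t" for t using assms by blast
  have disj: "closed_segment (lattice_point v) ?q \<inter> path_image ?g = {}"
    unfolding img P_def using segment_to_half_point_disjoint[OF step v v] by blast
  have "\<exists>k. winding_number (linepath (P s) (P (Suc s))) ?q =
      (Ln (?q - P (Suc s)) - Ln (?q - P s)) / (2 * pi * \<i>) + of_int k
    \<and> parity_sign k = crossing (x s - v) (x (Suc s) - v)" for s
    unfolding P_def by (rule winding_number_lattice_segment[OF step v v]) blast
  then obtain k where k: "\<And>s. winding_number (linepath (P s) (P (Suc s))) ?q =
      (Ln (?q - P (Suc s)) - Ln (?q - P s)) / (2 * pi * \<i>) + of_int (k s)"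
    "\<And>s. parity_sign (k s) = crossing (x s - v) (x (Suc s) - v)" by metis
  have "winding_number ?g ?q = (\<Sum>s<L. (Ln (?q - P (Suc s)) - Ln (?q - P s)) / (2 * pi * \<i>) + of_int (k s))"
  proof (subst winding_number_polygon)
    show "?q \<notin> path_image ?g" using disj by auto
  qed (simp only: L k)
  also have "\<dots> = (\<Sum>s<L. Ln (?q - P (Suc s)) - Ln (?q - P s)) / (2 * pi * \<i>) + of_int (\<Sum>s<L. k s)"
    by (simp only: sum.distrib sum_divide_distrib of_int_sum)
  also have "(\<Sum>s<L. Ln (?q - P (Suc s)) - Ln (?q - P s)) = 0"
    using P_L by (subst sum_lessThan_telescope) simp
  finally have wq: "winding_number ?g ?q = of_int (\<Sum>s<L. k s)" by simp
  have "winding_number ?g (lattice_point v) = winding_number ?g ?q"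
    by (rule winding_number_eq[OF path_polygon closed, of _ "closed_segment (lattice_point v) ?q"])
      (use disj in auto)
  with wq have w: "winding_number ?g (lattice_point v) = of_int (\<Sum>s<L. k s)" by simp
  have prod: "(\<Prod>s<L. crossing (x s - v) (x (Suc s) - v)) = parity_sign (\<Sum>s<L. k s)"
    by (simp add: parity_sign_sum flip: k(2))
  show ?thesis
  proof (cases "lattice_point v \<in> inside (path_image ?g)")
    case True
    have "winding_number ?g (lattice_point v) = 1 \<or> winding_number ?g (lattice_point v) = - 1"
      using simple_closed_path_winding_number_inside[OF simple_path_polygon] True by metis
    then have "(\<Sum>s<L. k s) = 1 \<or> (\<Sum>s<L. k s) = - 1"
      unfolding w by (metis of_int_1 of_int_eq_iff of_int_minus)
    then show ?thesis using True unfolding prod img by (auto simp: parity_sign_def)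
  next
    case False
    moreover have "lattice_point v \<notin> path_image ?g" using disj by auto
    ultimately have "lattice_point v \<in> outside (path_image ?g)"
      using inside_Un_outside[of "path_image ?g"] by blast
    then have "winding_number ?g (lattice_point v) = 0"
      by (rule winding_number_zero_in_outside[OF path_polygon closed])
    then have "(\<Sum>s<L. k s) = 0" unfolding w by (simp only: of_int_eq_0_iff)
    then show ?thesis using False unfolding prod img by (simp add: parity_sign_def)
  qed
qed

end

section \<open>Determinants over finite index sets\<close>

text \<open>The Leibniz sum runs over permutations of the index set itself, so that permutations of
  the vertices can be matched with configurations, and splitting or reflecting a vertex set needs no
  numbering.\<close>

definition set_det :: "'v set \<Rightarrow> ('v \<Rightarrow> 'v \<Rightarrow> 'r::comm_ring_1) \<Rightarrow> 'r" where
  "set_det V K = (\<Sum>p | p permutes V. of_int (sign p) * (\<Prod>v\<in>V. K v (p v)))"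

lemma set_det_cong:
  assumes "\<And>u w. u \<in> V \<Longrightarrow> w \<in> V \<Longrightarrow> K u w = K' u w"
  shows "set_det V K = set_det V K'"
  unfolding set_det_def
  by (intro sum.cong refl arg_cong2[where f = "(*)"] prod.cong) (auto simp: assms permutes_in_image)

lemma set_det_reindex:
  assumes f: "bij_betw f A B" and fin: "finite A"
  shows "set_det B K = set_det A (\<lambda>u w. K (f u) (f w))"
proof -
  let ?to = "map_permutation A f" and ?from = "map_permutation B (inv_into A f)"
  have inj: "inj_on f A" and B: "f ` A = B" using f by (auto simp: bij_betw_def)
  have g: "bij_betw (inv_into A f) B A" by (rule bij_betw_inv_into[OF f])
  show ?thesis
    unfolding set_det_def
  proof (rule sum.reindex_bij_witness[where i = ?to and j = ?from], goal_cases)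
    case (1 p)
    then show ?case
      by (intro map_permutation_compose_inv[OF g]) (use f in \<open>auto simp: bij_betw_inv_into_right\<close>)
  next
    case (2 p)
    then show ?case using map_permutation_permutes[OF g] by simp
  next
    case (3 p)
    then show ?case
      by (intro map_permutation_compose_inv[OF f]) (use f in \<open>auto simp: bij_betw_inv_into_left\<close>)
  next
    case (4 p)
    then show ?case using map_permutation_permutes[OF f] by simp
  next
    case (5 p)
    then have p: "p permutes B" by simp
    define q where "q = ?from p"
    have q: "q permutes A" unfolding q_def by (rule map_permutation_permutes[OF g p])
    have pq: "p = ?to q" unfolding q_def
      by (rule map_permutation_compose_inv[OF g p, symmetric])
        (use f in \<open>auto simp: bij_betw_inv_into_right\<close>)
    have "sign p = sign q" unfolding pq by (rule sign_map_permutation[OF inj q fin])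
    moreover have "(\<Prod>v\<in>B. K v (p v)) = (\<Prod>v\<in>A. K (f v) (f (q v)))"
      unfolding B[symmetric] pq
      by (subst prod.reindex[OF inj]) (auto intro!: prod.cong simp: map_permutation_apply[OF inj])
    ultimately show ?case unfolding q_def by simp
  qed
qed

lemma set_det_eq_det:
  assumes "bij_betw e {0..<n} V"
  shows "set_det V K = det (mat n n (\<lambda>(i, j). K (e i) (e j)))"
proof -
  have "set_det V K = set_det {0..<n} (\<lambda>i j. K (e i) (e j))"
    by (rule set_det_reindex[OF assms]) simp
  also have "\<dots> = det (mat n n (\<lambda>(i, j). K (e i) (e j)))"
    unfolding set_det_def
    by (subst det_def'[of _ n], simp, intro sum.cong refl arg_cong2[where f = "(*)"] prod.cong)
      (auto simp: permutes_in_image[of _ "{0..<n}", simplified])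
  finally show ?thesis .
qed

lemma set_det_times_transpose:
  assumes "finite V"
  shows "set_det V (\<lambda>u w. \<Sum>x\<in>V. K u x * K w x) = (set_det V K)\<^sup>2"
proof -
  obtain e where e: "bij_betw e {0..<card V} V"
    using ex_bij_betw_nat_finite[OF assms] by blast
  let ?n = "card V"
  define M where "M = mat ?n ?n (\<lambda>(i, j). K (e i) (e j))"
  have M: "M \<in> carrier_mat ?n ?n" by (simp add: M_def)
  have "mat ?n ?n (\<lambda>(i, j). \<Sum>x\<in>V. K (e i) x * K (e j) x) = M * transpose_mat M"
  proof (rule eq_matI)
    fix i j assume "i < dim_row (M * transpose_mat M)" "j < dim_col (M * transpose_mat M)"
    then have ij: "i < ?n" "j < ?n" by (auto simp: M_def)
    have "(\<Sum>x\<in>V. K (e i) x * K (e j) x) = (\<Sum>k = 0..<?n. K (e i) (e k) * K (e j) (e k))"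
      using sum.reindex_bij_betw[OF e, of "\<lambda>x. K (e i) x * K (e j) x"] by simp
    with ij show "mat ?n ?n (\<lambda>(i, j). \<Sum>x\<in>V. K (e i) x * K (e j) x) $$ (i, j) = (M * transpose_mat M) $$ (i, j)"
      by (simp add: M_def scalar_prod_def)
  qed (auto simp: M_def)
  then have "set_det V (\<lambda>u w. \<Sum>x\<in>V. K u x * K w x) = det (M * transpose_mat M)"
    by (simp add: set_det_eq_det[OF e])
  also have "\<dots> = det M * det M"
    by (subst det_mult[OF M]) (auto simp: det_transpose[OF M] M)
  also have "det M = set_det V K" by (simp add: set_det_eq_det[OF e] M_def)
  finally show ?thesis by (simp add: power2_eq_square)
qed

lemma set_det_Un:
  fixes K :: "'v \<Rightarrow> 'v \<Rightarrow> 'r :: idom"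
  assumes fin: "finite A" "finite B" and disj: "A \<inter> B = {}"
    and zero: "\<And>u w. u \<in> A \<Longrightarrow> w \<in> B \<Longrightarrow> K u w = 0" "\<And>u w. u \<in> A \<Longrightarrow> w \<in> B \<Longrightarrow> K w u = 0"
  shows "set_det (A \<union> B) K = set_det A K * set_det B K"
proof -
  let ?n = "card A" and ?m = "card B"
  obtain e where e: "bij_betw e {0..<?n} A" using ex_bij_betw_nat_finite[OF fin(1)] by blast
  obtain f where f: "bij_betw f {0..<?m} B" using ex_bij_betw_nat_finite[OF fin(2)] by blast
  define g where "g i = (if i < ?n then e i else f (i - ?n))" for i
  have eA: "e i \<in> A" if "i < ?n" for i using e that by (auto simp: bij_betw_def)
  have fB: "f i \<in> B" if "i < ?m" for i using f that by (auto simp: bij_betw_def)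
  have "bij_betw g ({0..<?n} \<union> {?n..<?n + ?m}) (A \<union> B)"
  proof (rule bij_betw_combine)
    show "bij_betw g {0..<?n} A"
      using e by (subst bij_betw_cong[of _ _ e]) (auto simp: g_def)
    have "bij_betw (\<lambda>i. i - ?n) {?n..<?n + ?m} {0..<?m}"
      by (rule bij_betw_byWitness[where f' = "\<lambda>i. i + ?n"]) auto
    from bij_betw_trans[OF this f] show "bij_betw g {?n..<?n + ?m} B"
      by (subst bij_betw_cong[of _ _ "f \<circ> (\<lambda>i. i - ?n)"]) (auto simp: g_def)
  qed (rule disj)
  also have "{0..<?n} \<union> {?n..<?n + ?m} = {0..<?n + ?m}" by auto
  finally have g: "bij_betw g {0..<?n + ?m} (A \<union> B)" .
  have "mat (?n + ?m) (?n + ?m) (\<lambda>(i, j). K (g i) (g j)) =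
      four_block_mat (mat ?n ?n (\<lambda>(i, j). K (e i) (e j))) (0\<^sub>m ?n ?m) (0\<^sub>m ?m ?n)
        (mat ?m ?m (\<lambda>(i, j). K (f i) (f j)))"
    by (rule eq_matI) (auto simp: g_def zero eA fB)
  then have "set_det (A \<union> B) K = det (mat ?n ?n (\<lambda>(i, j). K (e i) (e j))) * det (mat ?m ?m (\<lambda>(i, j). K (f i) (f j)))"
    by (simp add: set_det_eq_det[OF g] det_four_block_mat_lower_left_zero[of _ ?n _ ?m])
  then show ?thesis by (simp add: set_det_eq_det[OF e] set_det_eq_det[OF f])
qed

section \<open>Positivity of determinants of M-matrices\<close>

lemma sum_split_first_row:
  fixes f c :: "nat \<Rightarrow> 'a :: comm_ring_1"
  shows "(\<Sum>j<Suc n. f j * c j) = (\<Sum>j<Suc n. f j) * c 0 + (\<Sum>j<n. - f (Suc j) * (c 0 - c (Suc j)))"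
proof -
  have "(\<Sum>j<Suc n. f j * c j) = (\<Sum>j<Suc n. f j * c 0) + (\<Sum>j<Suc n. - f j * (c 0 - c j))"
    unfolding sum.distrib[symmetric] by (intro sum.cong) (auto simp: algebra_simps)
  then show ?thesis by (simp add: sum_distrib_right sum.lessThan_Suc_shift distrib_right del: sum.lessThan_Suc)
qed

text \<open>
  The first row is its sum times \<open>e\<^sub>0\<close> plus a combination of the rows \<open>e\<^sub>0 - e\<^sub>w\<close>. With the row
  \<open>e\<^sub>0 - e\<^sub>w\<close> instead, adding column \<open>0\<close> to column \<open>w\<close> leaves a smaller matrix of the same kind.
\<close>

lemma det_M_matrix_mem:
  fixes N :: "'a :: comm_ring_1 set"
  assumes N: "1 \<in> N" "0 \<in> N" "\<And>x y. x \<in> N \<Longrightarrow> y \<in> N \<Longrightarrow> x + y \<in> N"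
      "\<And>x y. x \<in> N \<Longrightarrow> y \<in> N \<Longrightarrow> x * y \<in> N"
    and "A \<in> carrier_mat n n"
    and "\<And>i j. i < n \<Longrightarrow> j < n \<Longrightarrow> i \<noteq> j \<Longrightarrow> - A $$ (i, j) \<in> N"
    and "\<And>i. i < n \<Longrightarrow> (\<Sum>j<n. A $$ (i, j)) \<in> N"
  shows "det A \<in> N"
  using assms(5-)
proof (induction n arbitrary: A)
  case 0
  then show ?case using N(1) by (simp add: det_dim_zero)
next
  case (Suc n)
  note A = Suc.prems(1) and off = Suc.prems(2) and row = Suc.prems(3)
  have sum_mem: "sum f S \<in> N" if "\<And>s. s \<in> S \<Longrightarrow> f s \<in> N" for f and S :: "nat set"
    using that by (induction S rule: infinite_finite_induct) (auto intro: N)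
  define M where "M = mat_delete A 0 0"
  have dims: "dim_row A = Suc n" "dim_col A = Suc n" using A by auto
  have M: "M \<in> carrier_mat n n" "\<And>i j. i < n \<Longrightarrow> j < n \<Longrightarrow> M $$ (i, j) = A $$ (Suc i, Suc j)"
    using A by (auto simp: M_def mat_delete_def)
  have rowM: "(\<Sum>j<n. A $$ (Suc i, Suc j)) + A $$ (Suc i, 0) \<in> N" if "i < n" for i
    using row[of "Suc i"] that by (simp add: sum.lessThan_Suc_shift add.commute del: sum.lessThan_Suc)
  have c0: "cofactor A 0 0 \<in> N"
  proof -
    have "det M \<in> N"
    proof (rule Suc.IH[OF M(1)])
      fix i assume i: "i < n"
      \<comment> \<open>Dropping column 0 changes the row sum by the negative of an off-diagonal
        entry, which lies in \<open>N\<close>.\<close>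
      have "(\<Sum>j<n. A $$ (Suc i, Suc j)) + A $$ (Suc i, 0) + - A $$ (Suc i, 0) \<in> N"
        by (rule N(3)[OF rowM[OF i] off]) (use i in auto)
      then show "(\<Sum>j<n. M $$ (i, j)) \<in> N" using i by (simp add: M)
    qed (auto simp: M intro: off)
    then show ?thesis by (simp add: cofactor_def M_def)
  qed
  have cw: "cofactor A 0 0 - cofactor A 0 (Suc w) \<in> N" if w: "w < n" for w
  proof -
    define B where "B = mat (Suc n) (Suc n) (\<lambda>(i, j). if i = 0 then if j = 0 then 1 else if j = Suc w then - 1 else 0
        else A $$ (i, j))"
    have B: "B \<in> carrier_mat (Suc n) (Suc n)" by (simp add: B_def)
    have cofB: "cofactor B 0 j = cofactor A 0 j" if "j < Suc n" for j
    proof -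
      have "mat_delete B 0 j = mat_delete A 0 j"
        by (rule eq_matI) (use that in \<open>auto simp: mat_delete_def B_def dims\<close>)
      then show ?thesis by (simp add: cofactor_def)
    qed
    have B0: "B $$ (0, 0) = 1" "\<And>j. j < n \<Longrightarrow> B $$ (0, Suc j) = (if j = w then - 1 else 0)"
      by (auto simp: B_def)
    have "det B = (\<Sum>j<Suc n. B $$ (0, j) * cofactor B 0 j)"
      by (rule laplace_expansion_row[OF B]) simp
    also have "\<dots> = cofactor A 0 0 + (\<Sum>j<n. (if j = w then - 1 else 0) * cofactor A 0 (Suc j))"
      using w by (simp add: sum.lessThan_Suc_shift cofB B0 del: sum.lessThan_Suc)
    also have "(\<Sum>j<n. (if j = w then - 1 else 0) * cofactor A 0 (Suc j)) = - cofactor A 0 (Suc w)"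
      using w by (simp add: if_distrib[of "\<lambda>x. x * _"] sum.delta cong: if_cong)
    finally have detB: "det B = cofactor A 0 0 - cofactor A 0 (Suc w)" by simp
    define B' where "B' = addcol 1 (Suc w) 0 B"
    have B': "B' \<in> carrier_mat (Suc n) (Suc n)" using B by (auto simp: B'_def mat_addcol_def)
    have "det B = det B'" unfolding B'_def by (rule det_addcol[symmetric, OF _ _ B]) auto
    also have "det B' = (\<Sum>j<Suc n. B' $$ (0, j) * cofactor B' 0 j)"
      by (rule laplace_expansion_row[OF B']) simp
    also have "\<dots> = cofactor B' 0 0"
    proof -
      have "B' $$ (0, 0) = 1" "\<And>j. j < n \<Longrightarrow> B' $$ (0, Suc j) = 0"
        by (auto simp: B'_def B_def)
      then show ?thesis by (simp add: sum.lessThan_Suc_shift del: sum.lessThan_Suc)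
    qed
    also have "\<dots> = det (mat_delete B' 0 0)" by (simp add: cofactor_def)
    also have "mat_delete B' 0 0 \<in> carrier_mat n n \<and> (\<forall>i<n. \<forall>j<n. mat_delete B' 0 0 $$ (i, j) =
        A $$ (Suc i, Suc j) + (if j = w then A $$ (Suc i, 0) else 0))"
      by (auto simp: mat_delete_def B'_def B_def)
    then have "det (mat_delete B' 0 0) \<in> N"
    proof (intro Suc.IH, goal_cases)
      case (2 i j)
      have "- A $$ (Suc i, Suc j) \<in> N" "- A $$ (Suc i, 0) \<in> N" using 2 by (auto intro: off)
      moreover from this have "- A $$ (Suc i, Suc j) + - A $$ (Suc i, 0) \<in> N" by (rule N(3))
      ultimately show ?case using 2 by (cases "j = w") simp_all
    next
      \<comment> \<open>Column 0 has been folded into column \<open>w\<close>, so the row sum is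
        that of the full row of \<open>A\<close>.\<close>
      case (3 i)
      then show ?case using rowM[of i] w by (simp add: sum.distrib)
    qed auto
    finally show ?thesis unfolding detB .
  qed
  have "det A = (\<Sum>j<Suc n. A $$ (0, j) * cofactor A 0 j)"
    by (rule laplace_expansion_row[OF A]) simp
  also have "\<dots> = (\<Sum>j<Suc n. A $$ (0, j)) * cofactor A 0 0 +
      (\<Sum>j<n. - A $$ (0, Suc j) * (cofactor A 0 0 - cofactor A 0 (Suc j)))"
    by (rule sum_split_first_row)
  also have "\<dots> \<in> N"
    by (intro N(3) N(4) sum_mem c0 cw row off) auto
  finally show ?case .
qed

text \<open>Nonnegativity is membership in a subsemiring \<open>N\<close> instead of an order, so
  that it can mean nonnegative coefficients of a polynomial.\<close>

lemma set_det_M_matrix_mem: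
  fixes N :: "'a :: comm_ring_1 set"
  assumes "1 \<in> N" "0 \<in> N" "\<And>x y. x \<in> N \<Longrightarrow> y \<in> N \<Longrightarrow> x + y \<in> N"
      "\<And>x y. x \<in> N \<Longrightarrow> y \<in> N \<Longrightarrow> x * y \<in> N"
    and fin: "finite V"
    and off: "\<And>u w. u \<in> V \<Longrightarrow> w \<in> V \<Longrightarrow> u \<noteq> w \<Longrightarrow> - K u w \<in> N"
    and row: "\<And>u. u \<in> V \<Longrightarrow> (\<Sum>w\<in>V. K u w) \<in> N"
  shows "set_det V K \<in> N"
proof -
  obtain e where e: "bij_betw e {0..<card V} V" using ex_bij_betw_nat_finite[OF fin] by blast
  have eV: "e i \<in> V" if "i < card V" for i using e that by (auto simp: bij_betw_def)
  have inj: "e i \<noteq> e j" if "i < card V" "j < card V" "i \<noteq> j" for i j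
    using e that by (auto simp: bij_betw_def inj_on_def)
  show ?thesis unfolding set_det_eq_det[OF e]
  proof (rule det_M_matrix_mem[OF assms(1-4)])
    fix i assume i: "i < card V"
    have "(\<Sum>j = 0..<card V. K (e i) (e j)) = (\<Sum>w\<in>V. K (e i) w)"
      by (rule sum.reindex_bij_betw[OF e])
    with row[OF eV[OF i]] i show "(\<Sum>j<card V. mat (card V) (card V) (\<lambda>(i, j). K (e i) (e j)) $$ (i, j)) \<in> N"
      by (simp add: lessThan_atLeast0)
  qed (auto intro: off eV dest: inj)
qed

section \<open>Configurations as permutations\<close>

text \<open>Fixed points give no arcs: they stand for the monopoles, and the arcs alone still
  determine the permutation.\<close>

definition arc_graph :: "('v \<Rightarrow> 'v) \<Rightarrow> ('v \<times> 'v) set" where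
  "arc_graph p = {(u, p u) | u. p u \<noteq> u}"

lemma arc_graph_inject: "arc_graph p = arc_graph q \<Longrightarrow> p = q"
proof
  fix u assume eq: "arc_graph p = arc_graph q"
  have "(u, w) \<in> arc_graph p \<longleftrightarrow> w = p u \<and> p u \<noteq> u" for p :: "'a \<Rightarrow> 'a" and w
    by (auto simp: arc_graph_def)
  with eq show "p u = q u" by metis
qed

lemma cycle_of_list_nth:
  assumes "distinct xs" "i < length xs"
  shows "cycle_of_list xs (xs ! i) = xs ! (Suc i mod length xs)"
proof -
  have "map (cycle_of_list xs) xs = rotate1 xs" using cyclic_rotation[OF assms(1), of 1] by simp
  then have "map (cycle_of_list xs) xs ! i = rotate1 xs ! i" by simp
  with assms(2) show ?thesis by (simp add: nth_rotate1)
qed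

lemma cycle_of_list_funpow_nth:
  assumes "distinct xs" "i < length xs"
  shows "(cycle_of_list xs ^^ k) (xs ! i) = xs ! ((i + k) mod length xs)"
proof (induction k)
  case (Suc k)
  have "(i + k) mod length xs < length xs" using assms(2) by (intro mod_less_divisor) auto
  then show ?case using Suc assms(1) by (simp add: cycle_of_list_nth mod_Suc_eq)
qed (use assms in simp)

lemma sign_cycle_of_list:
  "distinct xs \<Longrightarrow> xs \<noteq> [] \<Longrightarrow> sign (cycle_of_list xs) = (- 1) ^ (length xs - 1)"
proof (induction xs rule: cycle_of_list.induct)
  case (1 i j cs)
  have "sign (cycle_of_list (i # j # cs)) = sign (Transposition.transpose i j) * sign (cycle_of_list (j # cs))"
    unfolding cycle_of_list.simps by (rule sign_compose[OF permutation_swap_id permutation_of_cycle])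
  with 1 show ?case by (simp add: sign_swap_id del: cycle_of_list.simps)
qed auto

lemma cyclic_arcs_eq_graph:
  assumes "distinct xs" "2 \<le> length xs"
  shows "cyclic_arcs xs = arc_graph (cycle_of_list xs)"
    and "u \<in> set xs \<Longrightarrow> cycle_of_list xs u \<noteq> u"
proof -
  have ne: "cycle_of_list xs (xs ! i) \<noteq> xs ! i" if "i < length xs" for i
  proof -
    have "Suc i mod length xs \<noteq> i" using that assms(2) by (cases "Suc i = length xs") auto
    moreover have "Suc i mod length xs < length xs" using assms(2) by (intro mod_less_divisor) auto
    ultimately show ?thesis using that assms(1) by (simp add: cycle_of_list_nth nth_eq_iff_index_eq)
  qed
  then show n: "u \<in> set xs \<Longrightarrow> cycle_of_list xs u \<noteq> u" for u by (auto simp: in_set_conv_nth)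
  have "cycle_of_list xs u \<noteq> u \<longleftrightarrow> u \<in> set xs" for u using n id_outside_supp by metis
  then have "arc_graph (cycle_of_list xs) = {(u, cycle_of_list xs u) | u. u \<in> set xs}"
    by (simp add: arc_graph_def)
  also have "\<dots> = cyclic_arcs xs"
    using assms(1) by (auto simp: cyclic_arcs_def in_set_conv_nth cycle_of_list_nth)
  finally show "cyclic_arcs xs = arc_graph (cycle_of_list xs)" ..
qed

text \<open>A loop is the arc graph of a cyclic permutation, which is odd because its length is
  even. The last fact describes the loop as the orbit of any of its vertices and serves to identify
  loops that share a vertex.\<close>

lemma even_loopsE:
  assumes "l \<in> even_loops V E"
  obtains c where "l = arc_graph c" "c permutes loop_vertices l" "sign c = - 1"
    "loop_vertices l \<subseteq> V" "finite (loop_vertices l)" "loop_vertices l \<noteq> {}"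
    "\<And>u. u \<in> loop_vertices l \<Longrightarrow> c u \<noteq> u \<and> {u, c u} \<in> E"
    "\<And>u. u \<in> loop_vertices l \<Longrightarrow> l = range (\<lambda>k. ((c ^^ k) u, (c ^^ Suc k) u))"
proof -
  obtain xs where l: "l = cyclic_arcs xs" and xs: "distinct xs" "set xs \<subseteq> V" "even (length xs)"
      "2 \<le> length xs" "\<forall>(u, v)\<in>cyclic_arcs xs. {u, v} \<in> E"
    using assms unfolding even_loops_def by blast
  let ?c = "cycle_of_list xs"
  have lg: "l = arc_graph ?c" unfolding l by (rule cyclic_arcs_eq_graph(1)[OF xs(1,4)])
  have nf: "?c u \<noteq> u" if "u \<in> set xs" for u by (rule cyclic_arcs_eq_graph(2)[OF xs(1,4) that])
  have "?c u \<noteq> u \<longleftrightarrow> u \<in> set xs" for u using nf id_outside_supp by metis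
  then have lv: "loop_vertices l = set xs" unfolding lg loop_vertices_def arc_graph_def by force
  have xs0: "xs \<noteq> []" using xs(4) by auto
  show ?thesis
  proof (rule that[of ?c])
    show "?c permutes loop_vertices l" unfolding lv by (rule cycle_permutes)
    have "odd (length xs - 1)" using xs(3,4) by (cases "length xs") auto
    then show "sign ?c = - 1" using sign_cycle_of_list[OF xs(1) xs0] by simp
    show "?c u \<noteq> u \<and> {u, ?c u} \<in> E" if "u \<in> loop_vertices l" for u
    proof -
      have "?c u \<noteq> u" using that nf lv by blast
      then have "(u, ?c u) \<in> cyclic_arcs xs" unfolding l[symmetric] lg arc_graph_def by blast
      with \<open>?c u \<noteq> u\<close> xs(5) show ?thesis by blast
    qed
    show "l = range (\<lambda>k. ((?c ^^ k) u, (?c ^^ Suc k) u))" if u: "u \<in> loop_vertices l" for u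
    proof -
      obtain i where i: "i < length xs" "u = xs ! i" using u unfolding lv in_set_conv_nth by blast
      have pw: "(?c ^^ k) u = xs ! ((i + k) mod length xs)" for k
        using cycle_of_list_funpow_nth[OF xs(1) i(1)] i(2) by simp
      have "(?c ^^ k) u \<in> set xs" for k
        unfolding pw using xs0 by (intro nth_mem mod_less_divisor) auto
      moreover have "\<exists>k. w = (?c ^^ k) u" if w: "w \<in> set xs" for w
      proof -
        obtain j where j: "j < length xs" "w = xs ! j" using w unfolding in_set_conv_nth by blast
        have "(i + (length xs - i + j)) mod length xs = j" using i j by simp
        with pw[of "length xs - i + j"] j show ?thesis by metis
      qed
      moreover have "l = (\<lambda>u. (u, ?c u)) ` set xs"
        unfolding lg arc_graph_def using nf id_outside_supp[of _ xs] by blast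
      ultimately show ?thesis by (fastforce simp: image_iff)
    qed
  qed (use lg lv xs xs0 in auto)
qed

lemma even_loop_vertices:
  assumes "l \<in> even_loops V E"
  shows "loop_vertices l \<subseteq> V" "finite (loop_vertices l)" "loop_vertices l \<noteq> {}"
  by (rule even_loopsE[OF assms]; assumption)+

lemma funpow_agree:
  assumes "\<And>w. w \<in> S \<Longrightarrow> p w = c w" "\<And>w. w \<in> S \<Longrightarrow> c w \<in> S" "u \<in> S"
  shows "(p ^^ k) u = (c ^^ k) u" "(c ^^ k) u \<in> S"
  by (induction k) (use assms in auto)

text \<open>Cycles with disjoint supports multiply to a permutation whose arcs are the union of
  theirs, and each contributes a factor -1 to the sign.\<close>

lemma config_permutation:
  assumes "finite C" "C \<subseteq> even_loops V E"
    and "pairwise (\<lambda>l l'. disjnt (loop_vertices l) (loop_vertices l')) C"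
  shows "\<exists>p. p permutes (\<Union>l\<in>C. loop_vertices l) \<and> arc_graph p = \<Union>C \<and> sign p = (- 1) ^ card C"
  using assms
proof (induction C rule: finite_induct)
  case empty
  show ?case by (rule exI[of _ id]) (auto simp: arc_graph_def)
next
  case (insert l C)
  then obtain p where p: "p permutes (\<Union>l\<in>C. loop_vertices l)" "arc_graph p = \<Union>C" "sign p = (- 1) ^ card C"
    by (auto simp: pairwise_insert)
  obtain c where c: "l = arc_graph c" "c permutes loop_vertices l" "sign c = - 1" "finite (loop_vertices l)"
  proof -
    have "l \<in> even_loops V E" using insert.prems(1) by simp
    then show ?thesis using that by (rule even_loopsE) blast
  qed
  have fin: "finite (\<Union>l\<in>C. loop_vertices l)"
    using insert.hyps(1) insert.prems(1) even_loop_vertices(2)[of _ V E] by blast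
  have disj: "loop_vertices l \<inter> (\<Union>l\<in>C. loop_vertices l) = {}"
    using insert.prems(2) insert.hyps(2) by (auto simp: pairwise_insert disjnt_def)
  have pc: "p u = u \<or> c u = u" for u
    using disj permutes_not_in[OF p(1)] permutes_not_in[OF c(2)] by blast
  have cp: "(c \<circ> p) u = (if c u = u then p u else c u)" for u
  proof (cases "c u = u")
    case True
    have "c (p u) = p u"
    proof (cases "p u = u")
      case False
      then have "p u \<in> (\<Union>l\<in>C. loop_vertices l)" using p(1) by (metis permutes_in_image permutes_not_in)
      then show ?thesis using disj permutes_not_in[OF c(2)] by blast
    qed (use True in simp)
    then show ?thesis using True by simp
  next
    case False
    then show ?thesis using pc[of u] by auto
  qed
  have "c \<circ> p permutes (\<Union>l\<in>insert l C. loop_vertices l)"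
    using p(1) c(2) by (intro permutes_compose) (auto elim: permutes_subset)
  moreover have "arc_graph (c \<circ> p) = \<Union>(insert l C)"
    unfolding Union_insert c(1) p(2)[symmetric] arc_graph_def cp using pc by (auto; metis)
  moreover have "sign (c \<circ> p) = (- 1) ^ card (insert l C)"
    using insert.hyps p(3) c(3)
    by (simp add: sign_compose[OF permutes_imp_permutation[OF c(4,2)] permutes_imp_permutation[OF fin p(1)]])
  ultimately show ?case by blast
qed

section \<open>Configurations and permutations that move along edges\<close>

definition loop_permutations :: "'v set \<Rightarrow> 'v set set \<Rightarrow> ('v \<Rightarrow> 'v) set" where
  "loop_permutations V E = {p. p permutes V \<and> (\<forall>u. p u \<noteq> u \<longrightarrow> {u, p u} \<in> E)}"

lemma finite_even_loops:
  assumes "finite V" shows "finite (even_loops V E)"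
proof (rule finite_subset)
  show "even_loops V E \<subseteq> Pow (V \<times> V)"
    by (auto simp: even_loops_def cyclic_arcs_def)
      (metis mod_less_divisor nth_mem subsetD less_nat_zero_code not_gr_zero)
qed (use assms in simp)

lemma arc_graph_functional: "(u, w) \<in> arc_graph p \<longleftrightarrow> w = p u \<and> p u \<noteq> u"
  by (auto simp: arc_graph_def)

text \<open>The union of the arcs forgets how they are grouped into loops, but the loop through
  \<open>u\<close> is the forward orbit of \<open>u\<close> under \<open>p\<close> and so is the
  same in both configurations.\<close>

lemma config_determined_by_arcs:
  assumes C: "C \<subseteq> even_loops V E" and C': "C' \<subseteq> even_loops V E"
    and p: "arc_graph p = \<Union>C" "arc_graph p = \<Union>C'"
  shows "C \<subseteq> C'"
proof
  fix l assume l: "l \<in> C"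
  have orbit: "l = range (\<lambda>k. ((p ^^ k) u, (p ^^ Suc k) u))"
    if l: "l \<in> even_loops V E" "l \<subseteq> arc_graph p" and u: "u \<in> loop_vertices l" for l u
  proof -
    obtain c where c: "l = arc_graph c" "c permutes loop_vertices l"
      "\<And>u. u \<in> loop_vertices l \<Longrightarrow> c u \<noteq> u \<and> {u, c u} \<in> E"
      "\<And>u. u \<in> loop_vertices l \<Longrightarrow> l = range (\<lambda>k. ((c ^^ k) u, (c ^^ Suc k) u))"
      by (rule even_loopsE[OF l(1)]) blast
    have "p w = c w" if "w \<in> loop_vertices l" for w
      using c(1,3) l(2) that by (metis arc_graph_functional subsetD)
    moreover have "c w \<in> loop_vertices l" if "w \<in> loop_vertices l" for w
      using permutes_in_image[OF c(2)] that by simp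
    ultimately have "(p ^^ k) u = (c ^^ k) u" for k
      using funpow_agree(1)[of "loop_vertices l" p c u k] u by blast
    with c(4)[OF u] show ?thesis by (simp only:)
  qed
  have "loop_vertices l \<noteq> {}" using even_loop_vertices(3) C l by (metis subsetD)
  then obtain u w where uw: "(u, w) \<in> l" by (auto simp: loop_vertices_def)
  then obtain l' where l': "l' \<in> C'" "(u, w) \<in> l'" using p l by blast
  have "u \<in> loop_vertices l" "u \<in> loop_vertices l'" using uw l' by (force simp: loop_vertices_def)+
  then have "l = l'" using orbit[of l u] orbit[of l' u] l l' C C' p by blast
  then show "l \<in> C'" using l' by simp
qed

text \<open>The colour alternates along every nontrivial cycle of \<open>p\<close>, which forces
  even length; so each such cycle is a loop, a doubled edge if its length is 2.\<close>

lemma loop_permutation_config: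
  assumes fin: "finite V" and p: "p \<in> loop_permutations V E"
    and bip: "\<And>u w. {u, w} \<in> E \<Longrightarrow> colour u \<noteq> (colour w :: bool)"
  shows "\<exists>C\<in>monopole_dimer_configs V E. \<Union>C = arc_graph p"
proof -
  have pV: "p permutes V" and pE: "\<And>u. p u \<noteq> u \<Longrightarrow> {u, p u} \<in> E"
    using p by (auto simp: loop_permutations_def)
  have perm: "permutation p" using pV fin by (rule permutes_imp_permutation[rotated])
  have inj: "p u = p w \<longleftrightarrow> u = w" for u w using permutes_inj[OF pV] by (auto simp: inj_def)
  let ?orb = "\<lambda>v. support p v"
  have len: "length (?orb v) = least_power p v" for v by simp
  have moved: "p ((p ^^ k) v) \<noteq> (p ^^ k) v" if "p v \<noteq> v" for v k
    by (induction k) (use that inj in auto)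
  have inV: "(p ^^ k) v \<in> V" if "p v \<noteq> v" for k v
    using that permutes_in_image[OF pV] permutes_not_in[OF pV, of v]
    by (induction k) auto
  have arcs: "cyclic_arcs (?orb v) = {(u, p u) | u. u \<in> set (?orb v)}" if "p v \<noteq> v" for v
  proof -
    let ?N = "least_power p v"
    have N: "0 < ?N" "(p ^^ ?N) v = v" using least_power_of_permutation[OF perm] by auto
    have nxt: "?orb v ! (Suc i mod ?N) = p (?orb v ! i)" if "i < ?N" for i
    proof (cases "Suc i = ?N")
      case True
      then have "p ((p ^^ i) v) = v" using N(2) by (metis funpow.simps(2) comp_apply)
      with True that N(1) show ?thesis by simp
    next
      case False
      with that show ?thesis by simp
    qed
    show ?thesis
    proof safe
      fix a b assume "(a, b) \<in> cyclic_arcs (?orb v)"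
      then obtain i where i: "i < ?N" "a = ?orb v ! i" "b = ?orb v ! (Suc i mod ?N)"
        by (auto simp: cyclic_arcs_def simp del: nth_map)
      then show "\<exists>u. (a, b) = (u, p u) \<and> u \<in> set (?orb v)"
        using nxt[OF i(1)] nth_mem[of i "?orb v"] by simp
    next
      fix a assume "a \<in> set (?orb v)"
      then obtain i where i: "i < ?N" "a = ?orb v ! i" by (metis in_set_conv_nth len)
      then show "(a, p a) \<in> cyclic_arcs (?orb v)"
        unfolding cyclic_arcs_def len using nxt[OF i(1)] by (metis (mono_tags, lifting) mem_Collect_eq)
    qed
  qed
  have moved': "p u \<noteq> u" if "u \<in> set (?orb v)" "p v \<noteq> v" for u v
    using that moved by auto
  have colp: "colour ((p ^^ k) v) = (colour v \<longleftrightarrow> even k)" if "p v \<noteq> v" for v k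
  proof (induction k)
    case (Suc k)
    have "colour ((p ^^ k) v) \<noteq> colour (p ((p ^^ k) v))" by (rule bip[OF pE[OF moved[OF that]]])
    with Suc show ?case by auto
  qed simp
  have loop: "cyclic_arcs (?orb v) \<in> even_loops V E" if v: "p v \<noteq> v" for v
  proof -
    let ?N = "least_power p v"
    have N: "0 < ?N" "(p ^^ ?N) v = v" using least_power_of_permutation[OF perm] by auto
    have "even ?N" using colp[OF v, of ?N] N(2) by auto
    moreover have "2 \<le> k" if "even k" "0 < k" for k :: nat using that by presburger
    ultimately have "even ?N" "2 \<le> ?N" using N(1) by blast+
    moreover have "distinct (?orb v)" by (rule cycle_of_permutation[OF perm])
    moreover have "set (?orb v) \<subseteq> V" using inV[OF v] by auto
    moreover have "\<forall>(u, w)\<in>cyclic_arcs (?orb v). {u, w} \<in> E"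
      unfolding arcs[OF v] using moved' pE v by fastforce
    ultimately have "distinct (?orb v) \<and> set (?orb v) \<subseteq> V \<and> even (length (?orb v)) \<and> 2 \<le> length (?orb v) \<and>
        (\<forall>(u, w)\<in>cyclic_arcs (?orb v). {u, w} \<in> E)"
      unfolding len by blast
    then show ?thesis unfolding even_loops_def by blast
  qed
  define C where "C = {cyclic_arcs (?orb v) | v. p v \<noteq> v}"
  have lv: "loop_vertices (cyclic_arcs (?orb v)) = set (?orb v)" if "p v \<noteq> v" for v
    unfolding arcs[OF that] loop_vertices_def by force
  have "pairwise (\<lambda>l l'. disjnt (loop_vertices l) (loop_vertices l')) C"
  proof (rule pairwiseI)
    fix l l' assume "l \<in> C" "l' \<in> C" and ne: "l \<noteq> l'"
    then obtain v w where vw: "p v \<noteq> v" "l = cyclic_arcs (?orb v)" "p w \<noteq> w" "l' = cyclic_arcs (?orb w)"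
      by (auto simp: C_def)
    have "set (?orb v) \<noteq> set (?orb w)" using ne unfolding vw(2,4) arcs[OF vw(1)] arcs[OF vw(3)] by metis
    then have "set (?orb v) \<inter> set (?orb w) = {}"
      using disjoint_support[OF perm] unfolding disjoint_def by blast
    then show "disjnt (loop_vertices l) (loop_vertices l')"
      using vw lv by (simp add: disjnt_def)
  qed
  moreover have "C \<subseteq> even_loops V E" using loop by (auto simp: C_def)
  moreover have "\<Union>C = arc_graph p"
  proof (intro subset_antisym subsetI)
    fix a assume "a \<in> \<Union>C"
    then obtain v where "p v \<noteq> v" "a \<in> cyclic_arcs (?orb v)" by (auto simp: C_def)
    then show "a \<in> arc_graph p" unfolding arc_graph_def using arcs moved' by blast
  next
    fix a assume "a \<in> arc_graph p"
    then obtain u where u: "p u \<noteq> u" "a = (u, p u)" by (auto simp: arc_graph_def)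
    have "u \<in> set (?orb u)" using least_power_of_permutation(2)[OF perm, of u] by force
    then have "a \<in> cyclic_arcs (?orb u)" unfolding arcs[OF u(1)] using u(2) by blast
    with u(1) show "a \<in> \<Union>C" by (auto simp: C_def)
  qed
  ultimately show ?thesis by (auto simp: monopole_dimer_configs_def)
qed

text \<open>The minus sign in the Kasteleyn condition matches the sign -1 of an even cycle. Hence
  the weight of a configuration is exactly the Leibniz term of its permutation, with monopoles on
  the diagonal, and permutations that use a non-edge contribute 0.\<close>

theorem partition_function_eq_set_det:
  fixes ew :: "'v set \<Rightarrow> 'r :: comm_ring_1" and s :: "'v \<Rightarrow> 'v \<Rightarrow> int"
  assumes fin: "finite V"
    and bip: "\<And>u w. {u, w} \<in> E \<Longrightarrow> colour u \<noteq> (colour w :: bool)"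
    and kasteleyn: "\<And>l. l \<in> even_loops V E \<Longrightarrow>
      (- 1) ^ card (enclosed_vertices V pos l) = - (\<Prod>(u, w)\<in>l. s u w)"
  shows "partition_function V E pos ew vw =
    set_det V (\<lambda>u w. if u = w then vw u else if {u, w} \<in> E then of_int (s u w) * ew {u, w} else 0)"
proof -
  let ?K = "\<lambda>u w. if u = w then vw u else if {u, w} \<in> E then of_int (s u w) * ew {u, w} else 0"
  let ?G = "loop_permutations V E" and ?MC = "monopole_dimer_configs V E"
  let ?t = "\<lambda>p. of_int (sign p) * (\<Prod>v\<in>V. ?K v (p v))"
  have C: "C \<subseteq> even_loops V E" "finite C"
    "pairwise (\<lambda>l l'. disjnt (loop_vertices l) (loop_vertices l')) C" if "C \<in> ?MC" for C
    using that finite_subset[OF _ finite_even_loops[OF fin]] by (auto simp: monopole_dimer_configs_def)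
  have ex: "\<exists>p. p \<in> ?G \<and> arc_graph p = \<Union>C \<and> sign p = (- 1) ^ card C" if CM: "C \<in> ?MC" for C
  proof -
    obtain p where p: "p permutes (\<Union>l\<in>C. loop_vertices l)" "arc_graph p = \<Union>C" "sign p = (- 1) ^ card C"
      using config_permutation[OF C(2)[OF CM] C(1)[OF CM] C(3)[OF CM]] by blast
    have "(\<Union>l\<in>C. loop_vertices l) \<subseteq> V" using C(1)[OF CM] even_loop_vertices(1) by blast
    then have "p permutes V" using p(1) permutes_subset by blast
    moreover have "{u, p u} \<in> E" if "p u \<noteq> u" for u
    proof -
      have "(u, p u) \<in> \<Union>C" using that unfolding p(2)[symmetric] by (auto simp: arc_graph_def)
      then obtain l where l: "l \<in> even_loops V E" "(u, p u) \<in> l" using C(1)[OF CM] by blast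
      obtain c where c: "l = arc_graph c" "\<And>u. u \<in> loop_vertices l \<Longrightarrow> c u \<noteq> u \<and> {u, c u} \<in> E"
        by (rule even_loopsE[OF l(1)]) blast
      have "u \<in> loop_vertices l" using l(2) by (force simp: loop_vertices_def)
      with c l(2) show ?thesis by (simp add: arc_graph_functional)
    qed
    ultimately show ?thesis using p by (auto simp: loop_permutations_def)
  qed
  then obtain \<Phi> where \<Phi>: "\<And>C. C \<in> ?MC \<Longrightarrow> \<Phi> C \<in> ?G \<and> arc_graph (\<Phi> C) = \<Union>C \<and> sign (\<Phi> C) = (- 1) ^ card C"
    by metis
  have bij: "bij_betw \<Phi> ?MC ?G"
    unfolding bij_betw_def
  proof
    show "inj_on \<Phi> ?MC"
    proof (rule inj_onI)
      fix C C' assume CC: "C \<in> ?MC" "C' \<in> ?MC" "\<Phi> C = \<Phi> C'"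
      then have "arc_graph (\<Phi> C) = \<Union>C" "arc_graph (\<Phi> C) = \<Union>C'" using \<Phi> by metis+
      then show "C = C'" using config_determined_by_arcs C(1) CC by (metis subset_antisym)
    qed
    show "\<Phi> ` ?MC = ?G"
    proof safe
      fix p assume p: "p \<in> ?G"
      obtain C where "C \<in> ?MC" "\<Union>C = arc_graph p"
        using loop_permutation_config[where colour = colour, OF fin p bip] by blast
      then show "p \<in> \<Phi> ` ?MC" using \<Phi> arc_graph_inject by (metis image_eqI)
    qed (use \<Phi> in blast)
  qed
  have weight: "config_weight V pos ew vw C = ?t (\<Phi> C)" if CM: "C \<in> ?MC" for C
  proof -
    let ?p = "\<Phi> C"
    have p: "?p permutes V" "\<And>u. ?p u \<noteq> u \<Longrightarrow> {u, ?p u} \<in> E" "arc_graph ?p = \<Union>C" "sign ?p = (- 1) ^ card C"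
      using \<Phi>[OF CM] by (auto simp: loop_permutations_def)
    let ?W = "{u \<in> V. ?p u \<noteq> u}"
    have graph: "\<Union>C = (\<lambda>u. (u, ?p u)) ` ?W"
      using p(1) permutes_not_in[OF p(1)] unfolding p(3)[symmetric] arc_graph_def by blast
    have finl: "finite l" if "l \<in> C" for l
    proof (rule finite_subset)
      show "l \<subseteq> \<Union>C" using that by blast
      show "finite (\<Union>C)" unfolding graph using fin by simp
    qed
    have mono: "monopoles V C = {v \<in> V. ?p v = v}"
    proof -
      have "(\<Union>l\<in>C. loop_vertices l) = fst ` \<Union>C" by (auto simp: loop_vertices_def)
      also have "\<dots> = ?W" unfolding graph by force
      finally show ?thesis by (auto simp: monopoles_def)
    qed
    have lw: "loop_weight V pos ew l = - (\<Prod>(u, w)\<in>l. of_int (s u w) * ew {u, w})" if "l \<in> C" for l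
    proof -
      have "(- 1) ^ card (enclosed_vertices V pos l) = (of_int ((- 1) ^ card (enclosed_vertices V pos l)) :: 'r)"
        by simp
      also have "(- 1) ^ card (enclosed_vertices V pos l) = - (\<Prod>(u, w)\<in>l. s u w)"
        using kasteleyn that C(1)[OF CM] by blast
      also have "of_int \<dots> = - (\<Prod>(u, w)\<in>l. of_int (s u w) :: 'r)"
        by (simp add: case_prod_beta)
      finally show ?thesis by (simp add: loop_weight_def prod.distrib case_prod_beta)
    qed
    have "(\<Prod>l\<in>C. loop_weight V pos ew l) = (- 1) ^ card C * (\<Prod>l\<in>C. \<Prod>(u, w)\<in>l. of_int (s u w) * ew {u, w})"
      by (simp add: lw prod_uminus)
    also have "(\<Prod>l\<in>C. \<Prod>(u, w)\<in>l. of_int (s u w) * ew {u, w}) = (\<Prod>(u, w)\<in>\<Union>C. of_int (s u w) * ew {u, w})"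
    proof -
      have "l \<inter> l' = {}" if "l \<in> C" "l' \<in> C" "l \<noteq> l'" for l l'
      proof -
        have "disjnt (loop_vertices l) (loop_vertices l')" using C(3)[OF CM] that by (simp add: pairwise_def)
        then show ?thesis by (fastforce simp: loop_vertices_def disjnt_iff)
      qed
      then show ?thesis using finl by (subst prod.Union_disjoint) auto
    qed
    also have "\<dots> = (\<Prod>u\<in>?W. of_int (s u (?p u)) * ew {u, ?p u})"
      unfolding graph by (subst prod.reindex) (auto simp: inj_on_def)
    also have "\<dots> = (\<Prod>u\<in>?W. ?K u (?p u))" by (rule prod.cong) (use p(2) in auto)
    finally have "config_weight V pos ew vw C =
        (- 1) ^ card C * ((\<Prod>u\<in>?W. ?K u (?p u)) * (\<Prod>v | v \<in> V \<and> ?p v = v. ?K v (?p v)))"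
      by (simp add: config_weight_def mono mult.assoc)
    also have "(\<Prod>u\<in>?W. ?K u (?p u)) * (\<Prod>v | v \<in> V \<and> ?p v = v. ?K v (?p v)) = (\<Prod>v\<in>V. ?K v (?p v))"
      using fin by (subst prod.union_disjoint[symmetric]) (auto intro!: prod.cong)
    finally show ?thesis by (simp add: p(4))
  qed
  have "partition_function V E pos ew vw = (\<Sum>C\<in>?MC. ?t (\<Phi> C))"
    unfolding partition_function_def by (rule sum.cong[OF refl weight])
  also have "\<dots> = (\<Sum>p\<in>?G. ?t p)" by (rule sum.reindex_bij_betw[OF bij])
  also have "\<dots> = (\<Sum>p | p permutes V. ?t p)"
  proof (rule sum.mono_neutral_left)
    show "\<forall>p\<in>{p. p permutes V} - ?G. ?t p = 0"
    proof
      fix p assume p: "p \<in> {p. p permutes V} - ?G"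
      then obtain u where u: "p u \<noteq> u" "{u, p u} \<notin> E" by (auto simp: loop_permutations_def)
      then have "u \<in> V" using p permutes_not_in by fastforce
      with u have "(\<Prod>v\<in>V. ?K v (p v)) = 0" by (intro prod_zero[OF fin] bexI[of _ u]) auto
      then show "?t p = 0" by simp
    qed
  qed (use fin in \<open>auto simp: finite_permutations loop_permutations_def\<close>)
  finally show ?thesis by (simp add: set_det_def)
qed

section \<open>A Kasteleyn orientation of the grid\<close>

definition to_lattice :: "nat \<times> nat \<Rightarrow> int \<times> int" where
  "to_lattice v = (int (fst v), int (snd v))"

lemma to_lattice_inject [simp]: "to_lattice u = to_lattice w \<longleftrightarrow> u = w"
  by (auto simp: to_lattice_def prod_eq_iff)

lemma grid_pos_eq: "grid_pos v = lattice_point (to_lattice v)"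
  by (cases v) (simp add: grid_pos_def lattice_point_def to_lattice_def)

lemma grid_a_edge_iff:
  "{u, w} \<in> grid_a_edges m n \<longleftrightarrow> u \<in> grid_vertices m n \<and> w \<in> grid_vertices m n \<and>
     fst u = fst w \<and> (snd w = snd u + 1 \<or> snd u = snd w + 1)"
  by (cases u; cases w) (auto simp: grid_a_edges_def grid_vertices_def doubleton_eq_iff)

lemma grid_b_edge_iff:
  "{u, w} \<in> grid_b_edges m n \<longleftrightarrow> u \<in> grid_vertices m n \<and> w \<in> grid_vertices m n \<and>
     snd u = snd w \<and> (fst w = fst u + 1 \<or> fst u = fst w + 1)"
  by (cases u; cases w) (auto simp: grid_b_edges_def grid_vertices_def doubleton_eq_iff)

lemma grid_edge_unit_step:
  assumes "{u, w} \<in> grid_a_edges m n \<union> grid_b_edges m n"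
  shows "to_lattice w - to_lattice u \<in> unit_steps"
  using assms unfolding Un_iff grid_a_edge_iff grid_b_edge_iff
  by (cases u; cases w) (auto simp: to_lattice_def unit_steps_def)

text \<open>The first factor comes from the vertices on a cycle, the second from the rays of all
  grid vertices. Columns are numbered from 1, so \<open>fst u - 1\<close> of them lie to the
  left.\<close>

definition arc_sign :: "nat \<times> nat \<Rightarrow> nat \<times> nat \<Rightarrow> int" where
  "arc_sign u w = orientation_sign (to_lattice w - to_lattice u) *
     (if fst u = fst w then (- 1) ^ (fst u - 1) else 1)"

text \<open>The ray of \<open>v\<close> meets a vertical edge exactly if \<open>v\<close> lies
  strictly to its left at the height of its lower end, which happens for one vertex in each column
  further left.\<close>

lemma crossing_column:
  assumes "{u, w} \<in> grid_a_edges m n \<union> grid_b_edges m n"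
  shows "(\<Prod>v\<in>grid_vertices m n. crossing (to_lattice u - to_lattice v) (to_lattice w - to_lattice v)) =
    (if fst u = fst w then (- 1) ^ (fst u - 1) else 1)"
proof -
  let ?V = "grid_vertices m n"
  let ?S = "{v \<in> ?V. fst v < fst u \<and> snd u + snd w = 2 * snd v + 1}"
  have fin: "finite ?V" by (simp add: grid_vertices_def)
  have cr: "crossing (to_lattice u - to_lattice v) (to_lattice w - to_lattice v) =
      (if fst v < fst u \<and> snd u + snd w = 2 * snd v + 1 then - 1 else 1)" for v
    by (auto simp: crossing_def to_lattice_def)
  have "(\<Prod>v\<in>?V. crossing (to_lattice u - to_lattice v) (to_lattice w - to_lattice v)) = (- 1) ^ card ?S"
    unfolding cr using fin by (simp add: prod.If_cases Int_def)
  also have "\<dots> = (if fst u = fst w then (- 1) ^ (fst u - 1) else 1)"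
  proof (cases "fst u = fst w")
    case True
    have uw: "u \<in> ?V" "w \<in> ?V" "snd w = snd u + 1 \<or> snd u = snd w + 1"
      using assms True unfolding Un_iff grid_a_edge_iff grid_b_edge_iff by auto
    have "?S = {1..<fst u} \<times> {min (snd u) (snd w)}"
      using uw by (auto simp: grid_vertices_def)
    with True show ?thesis by (simp add: card_cartesian_product)
  next
    case False
    then have "snd u = snd w"
      using assms unfolding Un_iff grid_a_edge_iff grid_b_edge_iff by auto
    then have "snd u + snd w \<noteq> 2 * snd v + 1" for v :: "nat \<times> nat" by presburger
    then have empty: "?S = {}" by auto
    show ?thesis unfolding empty using False by simp
  qed
  finally show ?thesis .
qed

lemma kasteleyn_doubled_edge:
  assumes "{u, w} \<in> grid_a_edges m n \<union> grid_b_edges m n"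
  shows "arc_sign u w * arc_sign w u = - 1"
proof -
  have "orientation_sign (- d) = - orientation_sign d" if "d \<in> unit_steps" for d
    using that by (auto simp: unit_steps_def orientation_sign_def)
  from this[OF grid_edge_unit_step[OF assms]]
  have "orientation_sign (to_lattice u - to_lattice w) = - orientation_sign (to_lattice w - to_lattice u)"
    by simp
  moreover define o' e where "o' = orientation_sign (to_lattice w - to_lattice u)"
    and "e = (if fst u = fst w then (- 1) ^ (fst u - 1) else (1::int))"
  ultimately have "arc_sign u w * arc_sign w u = - ((o' * o') * (e * e))"
    by (simp add: arc_sign_def)
  moreover have "o' * o' = 1" by (simp add: o'_def orientation_sign_def)
  moreover have "e * e = 1" by (simp add: e_def flip: power_mult_distrib)
  ultimately show ?thesis by simp
qed

text \<open>For vertices off the cycle, being enclosed is a crossing parity. Completing the product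
  to all grid vertices costs the factor of the vertices on the cycle, known from
  \<open>prod_crossing\<close>, and then the product can be taken arc by arc. A doubled edge is a
  segment, encloses nothing and is treated separately.\<close>

theorem grid_kasteleyn:
  assumes "l \<in> even_loops (grid_vertices m n) (grid_a_edges m n \<union> grid_b_edges m n)"
  shows "(- 1) ^ card (enclosed_vertices (grid_vertices m n) grid_pos l) = - (\<Prod>(u, w)\<in>l. arc_sign u w)"
proof -
  let ?V = "grid_vertices m n" and ?E = "grid_a_edges m n \<union> grid_b_edges m n"
  have finV: "finite ?V" by (simp add: grid_vertices_def)
  obtain xs where l: "l = cyclic_arcs xs" and xs: "distinct xs" "set xs \<subseteq> ?V" "even (length xs)"
      "2 \<le> length xs" "\<forall>(u, v)\<in>cyclic_arcs xs. {u, v} \<in> ?E"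
    using assms unfolding even_loops_def by blast
  define L where "L = length xs"
  have L0: "0 < L" using xs(4) unfolding L_def by linarith
  have l_image: "l = (\<lambda>t. (xs ! t, xs ! (Suc t mod L))) ` {..<L}"
    unfolding l cyclic_arcs_def L_def by auto
  show ?thesis
  proof (cases "L = 2")
    case True
    then have l2: "l = {(xs ! 0, xs ! 1), (xs ! 1, xs ! 0)}"
      unfolding l_image by (auto simp: numeral_2_eq_2 lessThan_Suc)
    have ne: "xs ! 0 \<noteq> xs ! 1" using xs(1) True by (simp add: nth_eq_iff_index_eq L_def)
    have e: "{xs ! 0, xs ! 1} \<in> ?E" using xs(5) l2 unfolding l[symmetric] by simp
    have "loop_curve grid_pos l = closed_segment (grid_pos (xs ! 0)) (grid_pos (xs ! 1))"
      unfolding l2 loop_curve_def by (simp add: closed_segment_commute)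
    then have "inside (loop_curve grid_pos l) = {}" by (simp add: inside_convex)
    then have "enclosed_vertices ?V grid_pos l = {}" by (simp add: enclosed_vertices_def)
    moreover have "(\<Prod>(u, w)\<in>l. arc_sign u w) = - 1"
      unfolding l2 using ne kasteleyn_doubled_edge[OF e] by simp
    ultimately show ?thesis by simp
  next
    case False
    have "even L" using xs(3) by (simp add: L_def)
    have "3 \<le> L"
    proof -
      have "2 \<le> L" using xs(4) by (simp add: L_def)
      with False show ?thesis by linarith
    qed
    define x where "x t = to_lattice (xs ! (t mod L))" for t
    have modL: "t mod L < L" for t using L0 by simp
    have edge: "{xs ! (t mod L), xs ! (Suc t mod L)} \<in> ?E" for t
    proof -
      have "(xs ! (t mod L), xs ! (Suc (t mod L) mod L)) \<in> l" unfolding l_image using modL by blast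
      then show ?thesis using xs(5) unfolding l[symmetric] by (auto simp: mod_Suc_eq)
    qed
    interpret lattice_cycle x L
    proof
      show "3 \<le> L" by fact
      show "x (t + L) = x t" for t by (simp add: x_def)
      show "x (Suc t) - x t \<in> unit_steps" for t
        unfolding x_def by (rule grid_edge_unit_step[OF edge])
      show "x s \<noteq> x t" if st: "s < t" "t < s + L" for s t
      proof
        assume "x s = x t"
        then have "xs ! (s mod L) = xs ! (t mod L)" by (simp add: x_def)
        then have "s mod L = t mod L" using xs(1) modL by (simp add: nth_eq_iff_index_eq L_def)
        then have "L dvd t - s" using st mod_eq_dvd_iff_nat[of s t L] by simp
        with st show False by (auto dest!: dvd_imp_le)
      qed
    qed
    have inj: "inj_on (\<lambda>t. xs ! t) {..<L}" using xs(1) by (simp add: L_def inj_on_nth)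
    have xs_image: "set xs = (\<lambda>t. xs ! t) ` {..<L}"
      unfolding L_def set_conv_nth by blast
    have x_xs: "x t = to_lattice (xs ! t)" if "t < L" for t using that by (simp add: x_def)
    have prod_l: "(\<Prod>(u, w)\<in>l. g u w) = (\<Prod>t<L. g (xs ! (t mod L)) (xs ! (Suc t mod L)))"
      for g :: "nat \<times> nat \<Rightarrow> nat \<times> nat \<Rightarrow> int"
      unfolding l_image by (subst prod.reindex) (use inj in \<open>auto simp: inj_on_def\<close>)
    have curve: "loop_curve grid_pos l = (\<Union>t<L. closed_segment (P t) (P (Suc t)))"
      unfolding l_image loop_curve_def P_def x_def by (auto simp: grid_pos_eq)
    let ?c = "\<lambda>v. \<Prod>s<L. crossing (x s - to_lattice v) (x (Suc s) - to_lattice v)"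
    have inside: "grid_pos v \<in> inside (loop_curve grid_pos l) \<longleftrightarrow> ?c v = - 1" if "v \<notin> set xs" for v
    proof -
      have "to_lattice v \<notin> range x"
      proof
        assume "to_lattice v \<in> range x"
        then obtain t where "v = xs ! (t mod L)" by (auto simp: x_def)
        with that modL show False by (simp add: L_def)
      qed
      then show ?thesis unfolding curve grid_pos_eq by (rule inside_iff_crossing)
    qed
    have on_curve: "grid_pos v \<notin> inside (loop_curve grid_pos l)" if v: "v \<in> set xs" for v
    proof -
      obtain t where "t < L" "v = xs ! t" using v unfolding xs_image by blast
      then have "grid_pos v \<in> loop_curve grid_pos l"
        unfolding curve by (auto simp: P_def x_xs grid_pos_eq intro!: bexI[of _ t])
      then show ?thesis using inside_no_overlap by blast
    qed
    have c_cases: "?c v = 1 \<or> ?c v = - 1" for v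
    proof -
      have *: "(\<Prod>s<k. crossing (f s) (g s)) = 1 \<or> (\<Prod>s<k. crossing (f s) (g s)) = - 1" for k and f g :: "nat \<Rightarrow> int \<times> int"
        by (induction k) (use crossing_cases in \<open>auto simp: crossing_def\<close>)
      show ?thesis by (rule *)
    qed
    have "(- 1) ^ card (enclosed_vertices ?V grid_pos l) =
        (\<Prod>v\<in>?V. if grid_pos v \<in> inside (loop_curve grid_pos l) then - 1 else (1::int))"
      using finV by (simp add: prod.If_cases enclosed_vertices_def Int_def)
    also have "\<dots> = (\<Prod>v\<in>?V - set xs. if grid_pos v \<in> inside (loop_curve grid_pos l) then - 1 else 1)"
      using finV on_curve by (intro prod.mono_neutral_right) auto
    also have "\<dots> = (\<Prod>v\<in>?V - set xs. ?c v)"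
      by (intro prod.cong refl) (use inside c_cases in auto)
    \<comment> \<open>Signs are their own inverses, so dividing out the vertices on the cycle is
      multiplying by their factor.\<close>
    also have "\<dots> = (\<Prod>v\<in>?V. ?c v) * (\<Prod>v\<in>set xs. ?c v)"
    proof -
      have "(\<Prod>v\<in>?V. ?c v) = (\<Prod>v\<in>?V - set xs. ?c v) * (\<Prod>v\<in>set xs. ?c v)"
        by (rule prod.subset_diff[OF xs(2) finV])
      moreover have "(\<Prod>v\<in>set xs. ?c v) * (\<Prod>v\<in>set xs. ?c v) = 1"
        unfolding prod.distrib[symmetric] crossing_squared by simp
      ultimately show ?thesis by (simp add: mult.assoc)
    qed
    also have "(\<Prod>v\<in>set xs. ?c v) = (\<Prod>t<L. \<Prod>s<L. crossing (x s - x t) (x (Suc s) - x t))"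
      unfolding xs_image by (subst prod.reindex[OF inj]) (auto intro!: prod.cong simp: x_xs)
    also have "\<dots> = - (\<Prod>t<L. orientation_sign (x (Suc t) - x t))"
      by (rule prod_crossing[OF \<open>even L\<close>])
    also have "(\<Prod>v\<in>?V. ?c v) = (\<Prod>s<L. \<Prod>v\<in>?V. crossing (x s - to_lattice v) (x (Suc s) - to_lattice v))"
      by (rule prod.swap)
    also have "\<dots> = (\<Prod>s<L. if fst (xs ! (s mod L)) = fst (xs ! (Suc s mod L)) then (- 1) ^ (fst (xs ! (s mod L)) - 1) else 1)"
      unfolding x_def by (intro prod.cong refl crossing_column[OF edge])
    finally have "(- 1) ^ card (enclosed_vertices ?V grid_pos l) =
       - (\<Prod>t<L. orientation_sign (x (Suc t) - x t) *
        (if fst (xs ! (t mod L)) = fst (xs ! (Suc t mod L)) then (- 1) ^ (fst (xs ! (t mod L)) - 1) else 1))"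
      by (simp only: prod.distrib mult_minus_right mult.commute)
    then show ?thesis unfolding prod_l by (simp only: x_def arc_sign_def)
  qed
qed

lemma grid_Z_eq_set_det:
  "grid_Z m n a b z = set_det (grid_vertices m n)
    (\<lambda>u w. if u = w then z else if {u, w} \<in> grid_a_edges m n \<union> grid_b_edges m n
      then of_int (arc_sign u w) * (if {u, w} \<in> grid_a_edges m n then a else b) else 0)"
  unfolding grid_Z_def
proof (rule partition_function_eq_set_det[where colour = "\<lambda>v. even (fst v + snd v)"])
  show "finite (grid_vertices m n)" by (simp add: grid_vertices_def)
  show "even (fst u + snd u) \<noteq> even (fst w + snd w)"
    if "{u, w} \<in> grid_a_edges m n \<union> grid_b_edges m n" for u w
    using that unfolding Un_iff grid_a_edge_iff grid_b_edge_iff by auto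
qed (rule grid_kasteleyn)

section \<open>The square of the grid determinant\<close>

lemma set_det_hom:
  fixes h :: "'r :: comm_ring_1 \<Rightarrow> 's :: comm_ring_1"
  assumes add: "\<And>x y. h (x + y) = h x + h y" and mult: "\<And>x y. h (x * y) = h x * h y" and one: "h 1 = 1"
  shows "h (set_det V K) = set_det V (\<lambda>u w. h (K u w))"
proof -
  have zero: "h 0 = 0" using add[of 0 0] by simp
  have minus: "h (- x) = - h x" for x
    by (rule minus_unique[symmetric]) (simp add: zero flip: add)
  have sum: "h (sum f S) = (\<Sum>s\<in>S. h (f s))" for f :: "'b \<Rightarrow> 'r" and S
    by (induction S rule: infinite_finite_induct) (auto simp: zero add)
  have prod: "h (prod f S) = (\<Prod>s\<in>S. h (f s))" for f :: "'c \<Rightarrow> 'r" and S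
    by (induction S rule: infinite_finite_induct) (auto simp: one mult)
  have "h (of_int (sign p)) = of_int (sign p)" for p :: "'a \<Rightarrow> 'a"
    by (cases p rule: sign_cases) (auto simp: one minus)
  then show ?thesis by (simp add: set_det_def sum prod mult)
qed

lemma set_det_identity:
  assumes "finite V"
  shows "set_det V (\<lambda>u w. if u = w then 1 else 0) = (1 :: 'r :: comm_ring_1)"
proof -
  obtain e where e: "bij_betw e {0..<card V} V" using ex_bij_betw_nat_finite[OF assms] by blast
  have "mat (card V) (card V) (\<lambda>(i, j). if e i = e j then 1 else 0) = (1\<^sub>m (card V) :: 'r mat)"
    using e by (intro eq_matI) (auto simp: bij_betw_def inj_on_def)
  then show ?thesis by (simp add: set_det_eq_det[OF e])
qed

section \<open>Gram matrices of skew-symmetric path adjacency matrices\<close>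

definition step_sign :: "nat \<Rightarrow> nat \<Rightarrow> int" where
  "step_sign i k = (if k = i + 1 then 1 else if i = k + 1 then - 1 else 0)"

definition path_gram :: "nat \<Rightarrow> nat \<Rightarrow> nat \<Rightarrow> int" where
  "path_gram n i j = (\<Sum>k\<in>{1..n}. step_sign i k * step_sign j k)"

lemma step_sign_antisym: "step_sign k i = - step_sign i k"
  by (auto simp: step_sign_def)

lemma path_gram_parity: "even i \<noteq> even j \<Longrightarrow> path_gram n i j = 0"
  unfolding path_gram_def by (rule sum.neutral) (auto simp: step_sign_def)

lemma path_gram_offdiag: "i \<noteq> j \<Longrightarrow> path_gram n i j \<le> 0"
  unfolding path_gram_def by (rule sum_nonpos) (auto simp: step_sign_def)

lemma step_sign_reverse:
  assumes "i \<in> {1..n}" "k \<in> {1..n}"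
  shows "step_sign (n + 1 - i) k = - step_sign i (n + 1 - k)"
proof -
  have "k = n + 1 - i + 1 \<longleftrightarrow> i = n + 1 - k + 1" "n + 1 - i = k + 1 \<longleftrightarrow> n + 1 - k = i + 1"
    "n + 1 - i = k + 1 \<Longrightarrow> k \<noteq> n + 1 - i + 1"
    using assms unfolding atLeastAtMost_iff by linarith+
  then show ?thesis by (simp add: step_sign_def)
qed

text \<open>Reversing the path negates \<open>step_sign\<close>, and the two signs cancel in each
  product.\<close>

lemma path_gram_reverse:
  assumes "i \<in> {1..n}" "j \<in> {1..n}"
  shows "path_gram n (n + 1 - i) (n + 1 - j) = path_gram n i j"
proof -
  have "path_gram n i j = (\<Sum>k\<in>{1..n}. step_sign i (n + 1 - k) * step_sign j (n + 1 - k))"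
    unfolding path_gram_def
    by (rule sum.reindex_bij_witness[where i = "\<lambda>k. n + 1 - k" and j = "\<lambda>k. n + 1 - k"]) auto
  also have "\<dots> = path_gram n (n + 1 - i) (n + 1 - j)"
    unfolding path_gram_def
    by (rule sum.cong[OF refl]) (simp only: step_sign_reverse[OF assms(1)] step_sign_reverse[OF assms(2)] minus_mult_minus)
  finally show ?thesis ..
qed

text \<open>Only even \<open>k\<close> contribute to a row with odd index. Column \<open>k\<close>
  restricted to odd rows has the entries 1 at \<open>k - 1\<close> and -1 at \<open>k + 1\<close>,
  which cancel, except for \<open>k = n\<close>, where only the 1 is left. So this is a path
  Laplacian with an extra diagonal term at one end.\<close>

lemma path_gram_odd_row_sum:
  assumes "even n" "odd i" "i \<in> {1..n}"
  shows "0 \<le> (\<Sum>j | j \<in> {1..n} \<and> odd j. path_gram n i j)"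
proof -
  let ?O = "{j. j \<in> {1..n} \<and> odd j}"
  have fin: "finite ?O" by simp
  have col_sum: "(\<Sum>j\<in>?O. step_sign j k) = (if k = n then 1 else 0)" if k: "k \<in> {1..n}" "even k" for k
  proof -
    have "(\<Sum>j\<in>?O. step_sign j k) = (\<Sum>j\<in>?O. (if j = k - 1 then 1 else 0) - (if j = k + 1 then 1 else 0))"
      by (rule sum.cong) (use k in \<open>auto simp: step_sign_def\<close>)
    also have "\<dots> = (if k - 1 \<in> ?O then 1 else 0) - (if k + 1 \<in> ?O then 1 else 0)"
      by (simp only: sum_subtractf sum.delta[OF fin])
    also have "\<dots> = (if k = n then 1 else 0)"
    proof -
      have "k - 1 \<in> ?O" using k unfolding mem_Collect_eq atLeastAtMost_iff by presburger
      moreover have "k + 1 \<in> ?O \<longleftrightarrow> k \<noteq> n" using k by auto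
      ultimately show ?thesis by simp
    qed
    finally show ?thesis .
  qed
  have "(\<Sum>j\<in>?O. path_gram n i j) = (\<Sum>k\<in>{1..n}. step_sign i k * (\<Sum>j\<in>?O. step_sign j k))"
    unfolding path_gram_def sum_distrib_left by (rule sum.swap)
  also have "\<dots> \<ge> 0"
  proof (rule sum_nonneg)
    fix k assume k: "k \<in> {1..n}"
    show "0 \<le> step_sign i k * (\<Sum>j\<in>?O. step_sign j k)"
    proof (cases "even k")
      case True
      have "k = n \<Longrightarrow> 0 \<le> step_sign i k" using assms(3) by (auto simp: step_sign_def)
      then show ?thesis unfolding col_sum[OF k True] by simp
    next
      case False
      with assms(2) have "step_sign i k = 0" by (auto simp: step_sign_def)
      then show ?thesis by simp
    qed
  qed
  finally show ?thesis .
qed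

section \<open>The grid matrix and its product with its transpose\<close>

definition grid_gram :: "nat \<Rightarrow> nat \<Rightarrow> 'r::comm_ring_1 \<Rightarrow> 'r \<Rightarrow> 'r \<Rightarrow> nat \<times> nat \<Rightarrow> nat \<times> nat \<Rightarrow> 'r" where
  "grid_gram m n a b z u w =
     (if u = w then z\<^sup>2 else 0) +
     a\<^sup>2 * (if fst u = fst w then of_int (path_gram n (snd u) (snd w)) else 0) +
     b\<^sup>2 * (if snd u = snd w then of_int (path_gram m (fst u) (fst w)) else 0)"

lemma sum_fixed_fst:
  assumes "finite A" "finite B" "i \<in> A"
  shows "(\<Sum>x\<in>A \<times> B. if i = fst x then h x else 0) = (\<Sum>k\<in>B. h (i, k))"
proof -
  have "(\<Sum>x\<in>A \<times> B. if i = fst x then h x else 0) = (\<Sum>x\<in>{i} \<times> B. h x)"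
    by (rule sum.mono_neutral_cong_right) (use assms in auto)
  also have "\<dots> = (\<Sum>k\<in>B. h (i, k))"
    by (rule sum.reindex_bij_witness[where i = "\<lambda>k. (i, k)" and j = snd]) auto
  finally show ?thesis .
qed

lemma sum_fixed_snd:
  assumes "finite A" "finite B" "i \<in> B"
  shows "(\<Sum>x\<in>A \<times> B. if i = snd x then h x else 0) = (\<Sum>k\<in>A. h (k, i))"
proof -
  have "(\<Sum>x\<in>A \<times> B. if i = snd x then h x else 0) = (\<Sum>x\<in>A \<times> {i}. h x)"
    by (rule sum.mono_neutral_cong_right) (use assms in auto)
  also have "\<dots> = (\<Sum>k\<in>A. h (k, i))"
    by (rule sum.reindex_bij_witness[where i = "\<lambda>k. (k, i)" and j = fst]) auto
  finally show ?thesis .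
qed

text \<open>The minus sign at \<open>b\<close> is there because the step (1, 0) has orientation sign
  -1, whereas \<open>step_sign\<close> is 1 on increasing steps.\<close>

definition grid_matrix :: "'r::comm_ring_1 \<Rightarrow> 'r \<Rightarrow> 'r \<Rightarrow> nat \<times> nat \<Rightarrow> nat \<times> nat \<Rightarrow> 'r" where
  "grid_matrix a b z u w =
     (if u = w then z else 0) +
     a * of_int ((- 1) ^ (fst u - 1)) * (if fst u = fst w then of_int (step_sign (snd u) (snd w)) else 0) -
     b * (if snd u = snd w then of_int (step_sign (fst u) (fst w)) else 0)"

lemma grid_Z_eq_set_det_grid_matrix:
  "grid_Z m n a b z = set_det (grid_vertices m n) (grid_matrix a b z)"
  unfolding grid_Z_eq_set_det
proof (rule set_det_cong)
  fix u w assume uw: "u \<in> grid_vertices m n" "w \<in> grid_vertices m n"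
  obtain i j k l where c: "u = (i, j)" "w = (k, l)" by (cases u; cases w)
  show "(if u = w then z else if {u, w} \<in> grid_a_edges m n \<union> grid_b_edges m n
      then of_int (arc_sign u w) * (if {u, w} \<in> grid_a_edges m n then a else b) else 0) = grid_matrix a b z u w"
    using uw unfolding Un_iff grid_a_edge_iff grid_b_edge_iff c
    by (auto simp: grid_matrix_def step_sign_def arc_sign_def orientation_sign_def to_lattice_def)
qed


text \<open>Terms linear in \<open>z\<close> cancel because the rest of the matrix is
  skew-symmetric, terms with \<open>a * b\<close> because the signs of neighbouring columns are
  opposite.\<close>

lemma grid_matrix_times_transpose:
  fixes a b z :: "'r :: comm_ring_1"
  assumes u: "u \<in> grid_vertices m n" and w: "w \<in> grid_vertices m n"
  shows "(\<Sum>x\<in>grid_vertices m n. grid_matrix a b z u x * grid_matrix a b z w x) = grid_gram m n a b z u w"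
proof -
  let ?V = "grid_vertices m n"
  have V: "?V = {1..m} \<times> {1..n}" by (simp add: grid_vertices_def)
  have fin: "finite ?V" by (simp add: V)
  define \<epsilon> :: "nat \<times> nat \<Rightarrow> 'r" where "\<epsilon> u = of_int ((- 1) ^ (fst u - 1))" for u
  define T :: "nat \<Rightarrow> nat \<Rightarrow> 'r" where "T i k = of_int (step_sign i k)" for i k
  define A :: "nat \<times> nat \<Rightarrow> nat \<times> nat \<Rightarrow> 'r" where "A u x = (if fst u = fst x then \<epsilon> u * T (snd u) (snd x) else 0)" for u x
  define B :: "nat \<times> nat \<Rightarrow> nat \<times> nat \<Rightarrow> 'r" where "B u x = (if snd u = snd x then T (fst u) (fst x) else 0)" for u x
  define M :: "nat \<times> nat \<Rightarrow> nat \<times> nat \<Rightarrow> 'r" where "M u x = a * A u x - b * B u x" for u x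
  have K: "grid_matrix a b z u x = (if u = x then z else 0) + M u x" for u x
    by (simp add: grid_matrix_def M_def A_def B_def \<epsilon>_def T_def)
  have T_anti: "T k i = - T i k" for i k unfolding T_def by (subst step_sign_antisym) simp
  have M_anti: "M w u = - M u w"
  proof -
    have "A w u = - A u w" using T_anti[of "snd w" "snd u"] by (simp add: A_def \<epsilon>_def)
    moreover have "B w u = - B u w" using T_anti[of "fst w" "fst u"] by (simp add: B_def)
    ultimately show ?thesis by (simp add: M_def)
  qed
  have gram: "of_int (path_gram k i j) = (\<Sum>l\<in>{1..k}. T i l * T j l)" for k i j
    by (simp add: path_gram_def T_def)
  have \<epsilon>2: "\<epsilon> u * \<epsilon> u = 1" by (simp add: \<epsilon>_def flip: power_mult_distrib)
  have AA: "(\<Sum>x\<in>?V. A u x * A w x) = (if fst u = fst w then of_int (path_gram n (snd u) (snd w)) else 0)"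
  proof -
    have "(\<Sum>x\<in>?V. A u x * A w x) = (\<Sum>x\<in>?V. if fst u = fst x then \<epsilon> u * T (snd u) (snd x) * A w x else 0)"
      by (rule sum.cong) (auto simp: A_def)
    also have "\<dots> = (\<Sum>k\<in>{1..n}. \<epsilon> u * T (snd u) k * A w (fst u, k))"
      unfolding V using u by (subst sum_fixed_fst) (auto simp: V)
    also have "\<dots> = (if fst u = fst w then (\<Sum>k\<in>{1..n}. (\<epsilon> u * \<epsilon> u) * (T (snd u) k * T (snd w) k)) else 0)"
      by (auto simp: A_def \<epsilon>_def ac_simps intro!: sum.cong)
    finally show ?thesis by (simp only: \<epsilon>2 gram mult_1_left)
  qed
  have BB: "(\<Sum>x\<in>?V. B u x * B w x) = (if snd u = snd w then of_int (path_gram m (fst u) (fst w)) else 0)"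
  proof -
    have "(\<Sum>x\<in>?V. B u x * B w x) = (\<Sum>x\<in>?V. if snd u = snd x then T (fst u) (fst x) * B w x else 0)"
      by (rule sum.cong) (auto simp: B_def)
    also have "\<dots> = (\<Sum>k\<in>{1..m}. T (fst u) k * B w (k, snd u))"
      unfolding V using u by (subst sum_fixed_snd) (auto simp: V)
    finally show ?thesis by (auto simp: B_def gram)
  qed
  \<comment> \<open>The only vertex in the column of \<open>u\<close> and the row of
    \<open>w\<close> is \<open>(fst u, snd w)\<close>.\<close>
  have AB: "(\<Sum>x\<in>?V. A u x * B w x) = \<epsilon> u * (T (snd u) (snd w) * T (fst w) (fst u))"
    if u: "u \<in> ?V" and w: "w \<in> ?V" for u w
  proof -
    have "(\<Sum>x\<in>?V. A u x * B w x) = (\<Sum>x\<in>?V. if fst u = fst x then \<epsilon> u * T (snd u) (snd x) * B w x else 0)"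
      by (rule sum.cong) (auto simp: A_def)
    also have "\<dots> = (\<Sum>k\<in>{1..n}. \<epsilon> u * T (snd u) k * B w (fst u, k))"
      unfolding V using u by (subst sum_fixed_fst) (auto simp: V)
    also have "\<dots> = (\<Sum>k\<in>{1..n}. if snd w = k then \<epsilon> u * T (snd u) (snd w) * T (fst w) (fst u) else 0)"
      by (rule sum.cong) (auto simp: B_def)
    also have "\<dots> = \<epsilon> u * (T (snd u) (snd w) * T (fst w) (fst u))"
      using w by (simp add: V mem_Times_iff mult.assoc)
    finally show ?thesis .
  qed
  have cross: "(\<Sum>x\<in>?V. A u x * B w x) + (\<Sum>x\<in>?V. B u x * A w x) = 0"
  proof -
    have "(\<Sum>x\<in>?V. B u x * A w x) = \<epsilon> w * (T (snd w) (snd u) * T (fst u) (fst w))"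
      using AB[OF w u] by (simp add: mult.commute)
    also have "T (snd w) (snd u) * T (fst u) (fst w) = T (snd u) (snd w) * T (fst w) (fst u)"
      using T_anti[of "snd w" "snd u"] T_anti[of "fst u" "fst w"] by simp
    finally have "(\<Sum>x\<in>?V. A u x * B w x) + (\<Sum>x\<in>?V. B u x * A w x) =
        T (snd u) (snd w) * (T (fst w) (fst u) * (\<epsilon> u + \<epsilon> w))"
      using AB[OF u w] by (simp add: algebra_simps)
    \<comment> \<open>The factor \<open>T\<close> vanishes unless the columns are adjacent, and then
      the two signs \<open>\<epsilon>\<close> are opposite.\<close>
    also have "T (fst w) (fst u) * (\<epsilon> u + \<epsilon> w) = 0"
    proof (cases "step_sign (fst w) (fst u) = 0")
      case False
      then have "fst u = fst w + 1 \<or> fst w = fst u + 1" by (auto simp: step_sign_def split: if_splits)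
      moreover have "1 \<le> fst u" "1 \<le> fst w" using u w by (auto simp: V)
      ultimately have "fst u - 1 = Suc (fst w - 1) \<or> fst w - 1 = Suc (fst u - 1)" by linarith
      then have "\<epsilon> u + \<epsilon> w = 0" by (auto simp: \<epsilon>_def)
      then show ?thesis by simp
    qed (simp add: T_def)
    finally show ?thesis by simp
  qed
  have MM: "(\<Sum>x\<in>?V. M u x * M w x) = a\<^sup>2 * (\<Sum>x\<in>?V. A u x * A w x) + b\<^sup>2 * (\<Sum>x\<in>?V. B u x * B w x)"
  proof -
    have "(\<Sum>x\<in>?V. M u x * M w x) = a\<^sup>2 * (\<Sum>x\<in>?V. A u x * A w x) + b\<^sup>2 * (\<Sum>x\<in>?V. B u x * B w x)
        - a * b * ((\<Sum>x\<in>?V. A u x * B w x) + (\<Sum>x\<in>?V. B u x * A w x))"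
      unfolding sum_distrib_left sum.distrib[symmetric] sum_subtractf[symmetric]
      by (rule sum.cong) (auto simp: M_def algebra_simps power2_eq_square)
    then show ?thesis by (simp add: cross)
  qed
  have "(\<Sum>x\<in>?V. grid_matrix a b z u x * grid_matrix a b z w x) =
      (\<Sum>x\<in>?V. if u = x then z * (if u = w then z else 0) else 0) +
      ((\<Sum>x\<in>?V. if u = x then z * M w u else 0) + (\<Sum>x\<in>?V. if w = x then z * M u w else 0)) +
      (\<Sum>x\<in>?V. M u x * M w x)"
    unfolding K sum.distrib[symmetric] by (rule sum.cong) (auto simp: algebra_simps)
  also have "\<dots> = (if u = w then z\<^sup>2 else 0) + (\<Sum>x\<in>?V. M u x * M w x)"
    using u w fin by (simp add: M_anti power2_eq_square)
  finally show ?thesis by (simp add: MM AA BB grid_gram_def add.assoc)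
qed

section \<open>The parity classes of the grid\<close>

lemma grid_gram_split:
  fixes a b z :: "'r :: idom"
  assumes m: "even m" and n: "even n"
  shows "set_det (grid_vertices m n) (grid_gram m n a b z) =
    set_det ({i. i \<in> {1..m} \<and> odd i} \<times> {j. j \<in> {1..n} \<and> odd j}) (grid_gram m n a b z) ^ 4"
proof -
  let ?G = "grid_gram m n a b z"
  define O' :: "nat \<Rightarrow> nat set" where "O' k = {i. i \<in> {1..k} \<and> odd i}" for k
  define E' :: "nat \<Rightarrow> nat set" where "E' k = {i. i \<in> {1..k} \<and> even i}" for k
  have fin [simp]: "finite (O' k)" "finite (E' k)" for k by (auto simp: O'_def E'_def)
  have OE: "{1..k} = O' k \<union> E' k" for k by (auto simp: O'_def E'_def)
  have bij: "bij_betw (\<lambda>i. k + 1 - i) (O' k) (E' k)" if "even k" for k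
    by (rule bij_betw_byWitness[where f' = "\<lambda>i. k + 1 - i"])
      (use that in \<open>auto simp: O'_def E'_def\<close>)
  have zero: "?G u w = 0" if "even (fst u) \<noteq> even (fst w) \<or> even (snd u) \<noteq> even (snd w)" for u w
    using that path_gram_parity[of "fst u" "fst w" m] path_gram_parity[of "snd u" "snd w" n]
    by (auto simp: grid_gram_def)
  have fst_split: "set_det ({1..m} \<times> X) ?G = set_det (O' m \<times> X) ?G * set_det (E' m \<times> X) ?G" if "finite X" for X
  proof -
    have split: "{1..m} \<times> X = O' m \<times> X \<union> E' m \<times> X" by (subst OE) auto
    show ?thesis
      unfolding split
    proof (rule set_det_Un)
      fix u w assume "u \<in> O' m \<times> X" "w \<in> E' m \<times> X"
      then have "odd (fst u)" "even (fst w)" by (auto simp: O'_def E'_def)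
      then show "?G u w = 0" "?G w u = 0" by (auto intro: zero)
    qed (use that in \<open>auto simp: O'_def E'_def\<close>)
  qed
  have snd_split: "set_det (X \<times> {1..n}) ?G = set_det (X \<times> O' n) ?G * set_det (X \<times> E' n) ?G" if "finite X" for X
  proof -
    have split: "X \<times> {1..n} = X \<times> O' n \<union> X \<times> E' n" by (subst OE) auto
    show ?thesis
      unfolding split
    proof (rule set_det_Un)
      fix u w assume "u \<in> X \<times> O' n" "w \<in> X \<times> E' n"
      then have "odd (snd u)" "even (snd w)" by (auto simp: O'_def E'_def)
      then show "?G u w = 0" "?G w u = 0" by (auto intro: zero)
    qed (use that in \<open>auto simp: O'_def E'_def\<close>)
  qed
  have fst_flip: "set_det (E' m \<times> X) ?G = set_det (O' m \<times> X) ?G" if "finite X" for X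
  proof -
    let ?f = "\<lambda>v. (m + 1 - fst v, snd v)"
    have "bij_betw ?f (O' m \<times> X) (E' m \<times> X)"
      using bij_betw_map_prod[OF bij[OF m] bij_betw_id[of X]] by (simp only: map_prod_def case_prod_unfold id_apply)
    then have "set_det (E' m \<times> X) ?G = set_det (O' m \<times> X) (\<lambda>u w. ?G (?f u) (?f w))"
      using that by (intro set_det_reindex) auto
    also have "\<dots> = set_det (O' m \<times> X) ?G"
    proof (rule set_det_cong)
      fix u w assume "u \<in> O' m \<times> X" "w \<in> O' m \<times> X"
      then have uw: "fst u \<in> {1..m}" "fst w \<in> {1..m}" by (auto simp: O'_def)
      then have "m + 1 - fst u = m + 1 - fst w \<longleftrightarrow> fst u = fst w" by auto
      then show "?G (?f u) (?f w) = ?G u w"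
        using path_gram_reverse[OF uw] by (simp add: grid_gram_def prod_eq_iff)
    qed
    finally show ?thesis .
  qed
  have snd_flip: "set_det (X \<times> E' n) ?G = set_det (X \<times> O' n) ?G" if "finite X" for X
  proof -
    let ?f = "\<lambda>v. (fst v, n + 1 - snd v)"
    have "bij_betw ?f (X \<times> O' n) (X \<times> E' n)"
      using bij_betw_map_prod[OF bij_betw_id[of X] bij[OF n]] by (simp only: map_prod_def case_prod_unfold id_apply)
    then have "set_det (X \<times> E' n) ?G = set_det (X \<times> O' n) (\<lambda>u w. ?G (?f u) (?f w))"
      using that by (intro set_det_reindex) auto
    also have "\<dots> = set_det (X \<times> O' n) ?G"
    proof (rule set_det_cong)
      fix u w assume "u \<in> X \<times> O' n" "w \<in> X \<times> O' n"
      then have uw: "snd u \<in> {1..n}" "snd w \<in> {1..n}" by (auto simp: O'_def)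
      then have "n + 1 - snd u = n + 1 - snd w \<longleftrightarrow> snd u = snd w" by auto
      then show "?G (?f u) (?f w) = ?G u w"
        using path_gram_reverse[OF uw] by (simp add: grid_gram_def prod_eq_iff)
    qed
    finally show ?thesis .
  qed
  have "set_det (grid_vertices m n) ?G = set_det (O' m \<times> O' n) ?G ^ 4"
    by (simp only: grid_vertices_def fst_split fst_flip snd_split snd_flip fin finite_atLeastAtMost
        power4_eq_xxxx mult.assoc)
  then show ?thesis by (simp add: O'_def)
qed

text \<open>Off-diagonal entries of the path Gram matrices are nonpositive. A row sum is
  \<open>z\<^sup>2\<close> plus nonnegative multiples of \<open>a\<^sup>2\<close> and
  \<open>b\<^sup>2\<close>, because the sum over a row of the product set runs once along each of
  two paths restricted to odd indices.\<close>

lemma grid_gram_det_mem: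
  fixes a b z :: "'r :: comm_ring_1"
  assumes m: "even m" and n: "even n"
    and N: "1 \<in> N" "0 \<in> N" "\<And>x y. x \<in> N \<Longrightarrow> y \<in> N \<Longrightarrow> x + y \<in> N"
      "\<And>x y. x \<in> N \<Longrightarrow> y \<in> N \<Longrightarrow> x * y \<in> N"
    and abz: "a \<in> N" "b \<in> N" "z \<in> N"
  shows "set_det ({i. i \<in> {1..m} \<and> odd i} \<times> {j. j \<in> {1..n} \<and> odd j}) (grid_gram m n a b z) \<in> N"
proof -
  define O' :: "nat \<Rightarrow> nat set" where "O' k = {i. i \<in> {1..k} \<and> odd i}" for k
  have fin: "finite (O' k)" for k by (auto simp: O'_def)
  have nat_mem: "of_nat k \<in> N" for k by (induction k) (auto intro: N)
  have int_mem: "of_int k \<in> N" if "0 \<le> k" for k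
    using nat_mem[of "nat k"] that by (simp only: of_nat_nat)
  have sq: "x\<^sup>2 \<in> N" if "x \<in> N" for x unfolding power2_eq_square by (rule N(4)[OF that that])
  have "set_det (O' m \<times> O' n) (grid_gram m n a b z) \<in> N"
  proof (rule set_det_M_matrix_mem[OF N])
    show "finite (O' m \<times> O' n)" using fin by simp
  next
    fix u w :: "nat \<times> nat" assume ne: "u \<noteq> w"
    have 1: "- (if fst u = fst w then of_int (path_gram n (snd u) (snd w)) else 0 :: 'r) \<in> N"
      using path_gram_offdiag[of "snd u" "snd w" n] ne int_mem[of "- path_gram n (snd u) (snd w)"] N(2)
      by (auto simp: prod_eq_iff)
    have 2: "- (if snd u = snd w then of_int (path_gram m (fst u) (fst w)) else 0 :: 'r) \<in> N"
      using path_gram_offdiag[of "fst u" "fst w" m] ne int_mem[of "- path_gram m (fst u) (fst w)"] N(2)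
      by (auto simp: prod_eq_iff)
    have "- grid_gram m n a b z u w =
        a\<^sup>2 * - (if fst u = fst w then of_int (path_gram n (snd u) (snd w)) else 0) +
        b\<^sup>2 * - (if snd u = snd w then of_int (path_gram m (fst u) (fst w)) else 0)"
      using ne by (simp add: grid_gram_def)
    also have "\<dots> \<in> N" by (intro N(3) N(4) sq abz 1 2)
    finally show "- grid_gram m n a b z u w \<in> N" .
  next
    fix u :: "nat \<times> nat" assume u: "u \<in> O' m \<times> O' n"
    then have u': "fst u \<in> O' m" "snd u \<in> O' n" by auto
    have "(\<Sum>w\<in>O' m \<times> O' n. grid_gram m n a b z u w) =
        (\<Sum>w\<in>O' m \<times> O' n. if u = w then z\<^sup>2 else 0) +
        a\<^sup>2 * (\<Sum>w\<in>O' m \<times> O' n. if fst u = fst w then of_int (path_gram n (snd u) (snd w)) else 0) +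
        b\<^sup>2 * (\<Sum>w\<in>O' m \<times> O' n. if snd u = snd w then of_int (path_gram m (fst u) (fst w)) else 0)"
      by (simp only: grid_gram_def sum.distrib sum_distrib_left)
    also have "\<dots> = z\<^sup>2 + a\<^sup>2 * of_int (\<Sum>j\<in>O' n. path_gram n (snd u) j) + b\<^sup>2 * of_int (\<Sum>i\<in>O' m. path_gram m (fst u) i)"
      using u fin by (simp add: sum_fixed_fst[OF fin fin u'(1)] sum_fixed_snd[OF fin fin u'(2)])
    also have "\<dots> \<in> N"
      using u' path_gram_odd_row_sum[OF n, of "snd u"] path_gram_odd_row_sum[OF m, of "fst u"]
      by (intro N(3) N(4) sq abz int_mem) (auto simp: O'_def)
    finally show "(\<Sum>w\<in>O' m \<times> O' n. grid_gram m n a b z u w) \<in> N" .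
  qed
  then show ?thesis by (simp add: O'_def)
qed

section \<open>Polynomials with nonnegative coefficients\<close>

lemma coeff3_mult:
  "coeff3 (P * Q) i j k = (\<Sum>x\<le>i. \<Sum>y\<le>j. \<Sum>w\<le>k. coeff3 P x y w * coeff3 Q (i - x) (j - y) (k - w))"
  by (simp add: coeff3_def coeff_mult coeff_sum)

definition nonneg_poly3 :: "poly3 set" where
  "nonneg_poly3 = {P. \<forall>i j k. 0 \<le> coeff3 P i j k}"

lemma nonneg_poly3_closed:
  shows "1 \<in> nonneg_poly3" "0 \<in> nonneg_poly3"
    and "P \<in> nonneg_poly3 \<Longrightarrow> Q \<in> nonneg_poly3 \<Longrightarrow> P + Q \<in> nonneg_poly3"
    and "P \<in> nonneg_poly3 \<Longrightarrow> Q \<in> nonneg_poly3 \<Longrightarrow> P * Q \<in> nonneg_poly3"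
    and "var_a \<in> nonneg_poly3" "var_b \<in> nonneg_poly3" "var_z \<in> nonneg_poly3"
proof -
  show "P * Q \<in> nonneg_poly3" if "P \<in> nonneg_poly3" "Q \<in> nonneg_poly3"
    using that unfolding nonneg_poly3_def mem_Collect_eq coeff3_mult
    by (intro allI sum_nonneg mult_nonneg_nonneg) auto
qed (auto simp: nonneg_poly3_def coeff3_def var_a_def var_b_def var_z_def coeff_pCons one_pCons split: nat.split)

theorem mainTheorem5:
  fixes m n :: nat
  assumes "2 \<le> m" and "even m" and "2 \<le> n" and "even n"
  shows "\<exists>P :: poly3. grid_Z m n var_a var_b var_z = P ^ 2 \<and>
           (\<forall>i j k. coeff3 P i j k \<noteq> 0 \<longrightarrow> coeff3 P i j k > 0)"
proof -
  let ?V = "grid_vertices m n"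
  define Z where "Z = grid_Z m n var_a var_b var_z"
  define Q where "Q = set_det ({i. i \<in> {1..m} \<and> odd i} \<times> {j. j \<in> {1..n} \<and> odd j})
      (grid_gram m n var_a var_b var_z)"
  have fin: "finite ?V" by (simp add: grid_vertices_def)
  have Z: "Z = set_det ?V (grid_matrix var_a var_b var_z)"
    unfolding Z_def by (rule grid_Z_eq_set_det_grid_matrix)
  have "Z\<^sup>2 = set_det ?V (\<lambda>u w. \<Sum>x\<in>?V. grid_matrix var_a var_b var_z u x * grid_matrix var_a var_b var_z w x)"
    unfolding Z by (rule set_det_times_transpose[OF fin, symmetric])
  also have "\<dots> = set_det ?V (grid_gram m n var_a var_b var_z)"
    by (rule set_det_cong) (rule grid_matrix_times_transpose)
  also have "\<dots> = Q ^ 4" unfolding Q_def by (rule grid_gram_split[OF assms(2,4)])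
  finally have "Z\<^sup>2 = (Q\<^sup>2)\<^sup>2" by simp
  then have "Z = Q\<^sup>2 \<or> Z = - Q\<^sup>2" by (simp only: power2_eq_iff)
  moreover have "Z \<noteq> - Q\<^sup>2"
  proof
    assume neg: "Z = - Q\<^sup>2"
    \<comment> \<open>Evaluation at \<open>a = b = 0\<close> and \<open>z = 1\<close> turns the
      matrix into the identity, so \<open>Z\<close> takes the value 1, which is not minus a square
      of an integer.\<close>
    define h :: "poly3 \<Rightarrow> int" where "h P = poly (poly (poly P 0) 0) 1" for P
    have "h Z = set_det ?V (\<lambda>u w. h (grid_matrix var_a var_b var_z u w))"
      unfolding Z by (rule set_det_hom) (simp_all add: h_def)
    also have "\<dots> = set_det ?V (\<lambda>u w. if u = w then 1 else 0)"
      by (rule set_det_cong) (auto simp: h_def grid_matrix_def var_a_def var_b_def var_z_def)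
    also have "\<dots> = 1" by (rule set_det_identity[OF fin])
    finally have "1 = - (h Q)\<^sup>2" unfolding neg by (simp add: h_def)
    then show False using zero_le_power2[of "h Q"] by linarith
  qed
  ultimately have "Z = Q\<^sup>2" by blast
  moreover have "Q \<in> nonneg_poly3"
    unfolding Q_def by (rule grid_gram_det_mem[OF assms(2,4) nonneg_poly3_closed])
  ultimately show ?thesis
    unfolding Z_def nonneg_poly3_def by (intro exI[of _ Q]) (auto simp: order.strict_iff_order)
qed

end
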